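(* For every complex number $q$ with $|q|<1$, $$\sum_{k=0}^\infty \frac{q^{k}(1+q^{2k+1})\,P_4(q^{2k+1})}{(1-q^{2k+1})^6}-\phi^{12}(q)=256\,q\prod_{n=1}^\infty\frac{(1-q^{2n})^{12}}{(1-q^{2n-1})^{12}},$$ where $P_4(x)=x^4+236x^3+1446x^2+236x+1$ and $\phi(q)=\prod_{n=1}^\infty(1-q^n)$.
   Context: $\phi(q)=\prod_{n=1}^\infty (1-q^n)$ denotes Euler's function. *)

theory Defs
  imports "HOL-Analysis.Analysis"
begin

definition euler_phi :: "complex \<Rightarrow> complex" where
  "euler_phi q = (\<Prod>n. 1 - q ^ (n + 1))"

definition P4 :: "complex \<Rightarrow> complex" where
  "P4 x = x ^ 4 + 236 * x ^ 3 + 1446 * x ^ 2 + 236 * x + 1"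

text \<open>
  \<^const>\<open>suminf\<close> and \<^const>\<open>prodinf\<close> are total. The following facts show that the series and
  both products below genuinely converge, with non-vanishing denominators, on the unit disc.
\<close>

lemma one_minus_power_nonzero:
  fixes q :: complex
  assumes "norm q < 1" and "n > 0"
  shows "1 - q ^ n \<noteq> 0"
proof
  assume "1 - q ^ n = 0"
  then have "norm q ^ n = 1"
    by (metis eq_iff_diff_eq_0 norm_one norm_power)
  moreover have "norm q ^ n < 1"
    using assms by (simp add: power_less_one_iff)
  ultimately show False by simp
qed

lemma convergent_prod_one_minus_power:
  fixes q :: complex and f :: "nat \<Rightarrow> nat"
  assumes "norm q < 1" and "\<And>n. n \<le> f n"
  shows "convergent_prod (\<lambda>n. 1 - q ^ f n)"
proof -
  have "summable (\<lambda>n. norm (1 - q ^ f n - 1))"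
  proof (rule summable_comparison_test')
    show "summable (\<lambda>n. norm q ^ n)"
      using assms(1) by (simp add: summable_geometric)
    show "norm (norm (1 - q ^ f n - 1)) \<le> norm q ^ n" for n
      using assms by (simp add: norm_power power_decreasing)
  qed
  then show ?thesis
    by (intro abs_convergent_prod_imp_convergent_prod summable_imp_abs_convergent_prod)
qed

lemma convergent_prod_euler_phi:
  fixes q :: complex
  assumes "norm q < 1"
  shows "convergent_prod (\<lambda>n. 1 - q ^ (n + 1))"
  using assms by (intro convergent_prod_one_minus_power) auto

lemma convergent_prod_quotient:
  fixes q :: complex
  assumes "norm q < 1"
  shows "convergent_prod
    (\<lambda>n. (1 - q ^ (2 * (n + 1))) ^ 12 / (1 - q ^ (2 * (n + 1) - 1)) ^ 12)"
  using assms one_minus_power_nonzero[OF assms]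
  by (intro convergent_prod_divide convergent_prod_power convergent_prod_one_minus_power) auto

lemma summable_odd_lambert:
  fixes q :: complex
  assumes q: "norm q < 1"
  shows "summable (\<lambda>k. q ^ k * (1 + q ^ (2 * k + 1)) * P4 (q ^ (2 * k + 1))
    / (1 - q ^ (2 * k + 1)) ^ 6)"
proof -
  define h where "h k = (1 + q ^ (2 * k + 1)) * P4 (q ^ (2 * k + 1)) / (1 - q ^ (2 * k + 1)) ^ 6" for k
  have x: "(\<lambda>k. q ^ (2 * k + 1)) \<longlonglongrightarrow> 0"
    using LIMSEQ_subseq_LIMSEQ[OF LIMSEQ_power_zero[OF q], of "\<lambda>k. 2 * k + 1"]
    by (simp add: strict_mono_def o_def)
  have "h \<longlonglongrightarrow> (1 + 0) * (0 ^ 4 + 236 * 0 ^ 3 + 1446 * 0 ^ 2 + 236 * 0 + 1) / (1 - 0) ^ 6"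
    unfolding h_def P4_def by (intro tendsto_intros x) auto
  then have "Bseq h"
    by (rule convergent_imp_Bseq[OF convergentI])
  then obtain C where C: "\<And>k. norm (h k) \<le> C"
    unfolding Bseq_def by blast
  have "summable (\<lambda>k. q ^ k * h k)"
  proof (rule summable_comparison_test')
    show "summable (\<lambda>k. norm q ^ k * C)"
      using q by (intro summable_mult2 summable_geometric) simp
    show "norm (q ^ k * h k) \<le> norm q ^ k * C" for k
      using C[of k] by (simp add: norm_mult norm_power mult_left_mono)
  qed
  then show ?thesis
    by (simp add: h_def mult.assoc)
qed

end

theory Submission
  imports Defs
begin

text \<open>
  Write \<open>q = x\<^sup>2\<close> and \<open>\<psi>(q) = \<phi>(q\<^sup>2)\<^sup>2 / \<phi>(q)\<close>, so that the right-hand product is \<open>\<psi>(q)\<^sup>1\<^sup>2\<close>. Up to the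
  factor \<open>2 x\<close>, the series is the fifth moment of the odd coefficients
  \<open>c\<^sub>n = 1 / (x^(-n) - x^n)\<close>. The function \<open>\<Phi>(z) = \<Sum> c\<^sub>n exp (i n z)\<close>, over odd integers \<open>n\<close>, is a multiple
  of the Jacobi elliptic function sn. The addition law \<open>c\<^sub>i c\<^sub>j = c\<^sub>i\<^sub>+\<^sub>j (d\<^sub>i + d\<^sub>j) / 2\<close> with
  \<open>d\<^sub>n = (x^(-n) + x^n) c\<^sub>n\<close> makes the convolutions telescope and shows that \<open>\<Phi>\<close> satisfies
  \<open>\<Phi>'' = b \<Phi> - 8 \<Phi>\<^sup>3\<close>. Differentiating at 0 expresses the fifth moment by \<open>b\<close> and the first moment
  \<open>2 F\<close>, the first integral between 0 and \<open>\<pi>/2\<close> expresses \<open>b\<close> by \<open>F\<close> and \<open>G = - \<Phi>(\<pi>/2)\<^sup>2 / 4\<close>, and the upshot is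
  that the fifth moment is \<open>2 F (F\<^sup>2 / G - 16 G)\<^sup>2 + 512 F\<^sup>3\<close>. A bilateral Lambert series, evaluated with the
  triple product, gives \<open>F = x \<psi>(x\<^sup>2)\<^sup>4\<close> and \<open>G = x\<^sup>2 \<psi>(x\<^sup>4)\<^sup>4\<close>, and Jacobi's quartic theta identity turns
  \<open>F (F\<^sup>2 / G - 16 G)\<^sup>2\<close> into \<open>x \<phi>(x\<^sup>2)\<^sup>1\<^sup>2\<close>.
\<close>

subsection \<open>Sums over the integers\<close>

text \<open>The square root \<open>x\<close> of \<open>q\<close> appears because the series is a sum
  over odd \<open>n\<close>: expanding \<open>1 / (x^(-n) - x^n)\<close> geometrically gives the
  terms \<open>n^5 x^(n (2 k + 1))\<close>, and summing over \<open>n\<close> first produces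
  \<open>P4\<close>, since \<open>(1 + y) * P4 y\<close> is the numerator of the generating function
  of the fifth powers of odd numbers. The obstacle is that the convolutions of the
  \<open>c_n\<close> turn into sums of \<open>d_n\<close>, which tend to 1 and -1 at the two ends
  and are not summable; only differences, and hence the dependence on the frequency, can be
  evaluated. The leftover constants are collected in \<open>ode_coeff\<close> and never computed
  from their series: the first integral determines \<open>ode_coeff\<close>, because Phi vanishes at
  0 and its derivative vanishes at pi / 2. The bilateral Lambert series gives only the value at pi /
  2, hence G. F comes from it by descent: comparing the square of Phi at 0 and at pi / 2 yields the
  first moment for \<open>x ^ 2\<close>, so the construction is also applied to a square root of
  \<open>x\<close>.\<close>

lemma has_sum_int_split:
  fixes f :: "int \<Rightarrow> 'a :: {topological_comm_monoid_add, t2_space}"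
  assumes "((\<lambda>n::nat. f (int n)) has_sum A) UNIV" and "((\<lambda>n::nat. f (- 1 - int n)) has_sum B) UNIV"
  shows "(f has_sum (A + B)) UNIV"
proof -
  have 1: "(f has_sum A) {0..}"
    by (rule iffD1[OF has_sum_reindex_bij_betw[of int UNIV "{0..}" f] assms(1)])
       (rule bij_betwI[of _ _ _ nat], auto)
  have 2: "(f has_sum B) {..<0}"
    by (rule iffD1[OF has_sum_reindex_bij_betw[of "\<lambda>n. - 1 - int n" UNIV "{..<0}" f] assms(2)])
       (rule bij_betwI[of _ _ _ "\<lambda>k. nat (- 1 - k)"], auto)
  have "{0..} \<union> {..<0} = (UNIV :: int set)" "{0..} \<inter> {..<0} = ({} :: int set)" by auto
  then show ?thesis using has_sum_Un_disjoint[OF 1 2] by simp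
qed

lemma summable_on_int_split:
  fixes f :: "int \<Rightarrow> 'a :: {topological_comm_monoid_add, t2_space}"
  assumes "(\<lambda>n::nat. f (int n)) summable_on UNIV" and "(\<lambda>n::nat. f (- 1 - int n)) summable_on UNIV"
  shows "f summable_on UNIV"
  using has_sum_int_split[of f] assms unfolding summable_on_def by blast

text \<open>By induction on \<open>j\<close>: a factor \<open>n\<close> is absorbed by passing from
  the ratio \<open>r\<close> to some \<open>s\<close> with \<open>r < s < 1\<close>, since
  \<open>n * (r / s) ^ n\<close> is bounded.\<close>

lemma summable_power_geometric:
  fixes r :: real
  assumes "0 \<le> r" "r < 1"
  shows "summable (\<lambda>n. real n ^ j * r ^ n)"
  using assms
proof (induction j arbitrary: r)
  case 0
  then show ?case by (simp add: summable_geometric)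
next
  case (Suc j)
  obtain s where s: "r < s" "s < 1" using Suc.prems dense by blast
  have "(\<lambda>n. of_nat n * (r / s) ^ n) \<longlonglongrightarrow> 0"
    using s Suc.prems by (intro powser_times_n_limit_0) auto
  then have "Bseq (\<lambda>n. real n * (r / s) ^ n)"
    using convergent_imp_Bseq convergentI by blast
  then obtain K where K: "\<And>n. norm (real n * (r / s) ^ n) \<le> K" unfolding Bseq_def by blast
  show ?case
  proof (rule summable_comparison_test')
    show "summable (\<lambda>n. K * (real n ^ j * s ^ n))" using s Suc by (intro summable_mult Suc.IH) auto
    fix n :: nat
    have "norm (real n ^ Suc j * r ^ n) = norm (real n * (r / s) ^ n) * (real n ^ j * s ^ n)"
      using s Suc.prems by (simp add: abs_mult power_divide)
    also have "\<dots> \<le> K * (real n ^ j * s ^ n)"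
      using mult_right_mono[OF K[of n], of "real n ^ j * s ^ n"] s Suc.prems by simp
    finally show "norm (real n ^ Suc j * r ^ n) \<le> K * (real n ^ j * s ^ n)" .
  qed
qed

lemma summable_on_int_power_geometric:
  fixes r :: real
  assumes "0 \<le> r" "r < 1"
  shows "(\<lambda>n::int. \<bar>of_int n\<bar> ^ j * r ^ nat \<bar>n\<bar>) summable_on UNIV"
proof -
  have s: "summable (\<lambda>n. real n ^ j * r ^ n)" using assms by (rule summable_power_geometric)
  have A: "(\<lambda>n::nat. real n ^ j * r ^ n) summable_on UNIV"
    using s assms by (subst summable_on_UNIV_nonneg_real_iff) auto
  have B: "(\<lambda>n::nat. real (Suc n) ^ j * r ^ Suc n) summable_on UNIV"
    using iffD2[OF summable_Suc_iff s] assms by (subst summable_on_UNIV_nonneg_real_iff) auto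
  show ?thesis
  proof (rule summable_on_int_split)
    show "(\<lambda>n. \<bar>real_of_int (int n)\<bar> ^ j * r ^ nat \<bar>int n\<bar>) summable_on UNIV" using A by simp
    have "(\<lambda>n. \<bar>real_of_int (- 1 - int n)\<bar> ^ j * r ^ nat \<bar>- 1 - int n\<bar>) = (\<lambda>n::nat. real (Suc n) ^ j * r ^ Suc n)"
    proof
      fix n :: nat
      have "\<bar>real_of_int (- 1 - int n)\<bar> = real (Suc n)" "nat \<bar>- 1 - int n\<bar> = Suc n" by auto
      then show "\<bar>real_of_int (- 1 - int n)\<bar> ^ j * r ^ nat \<bar>- 1 - int n\<bar> = real (Suc n) ^ j * r ^ Suc n" by presburger
    qed
    then show "(\<lambda>n. \<bar>real_of_int (- 1 - int n)\<bar> ^ j * r ^ nat \<bar>- 1 - int n\<bar>) summable_on UNIV" using B by simp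
  qed
qed

lemma summable_on_int_comparison:
  fixes f :: "int \<Rightarrow> complex" and r :: real
  assumes "0 \<le> r" "r < 1" and "\<And>n. norm (f n) \<le> K * (\<bar>of_int n\<bar> ^ j * r ^ nat \<bar>n\<bar>)"
  shows "f summable_on UNIV"
proof (rule abs_summable_summable)
  show "(\<lambda>n. norm (f n)) summable_on UNIV"
    by (rule summable_on_comparison_test[OF summable_on_cmult_right[OF summable_on_int_power_geometric[OF assms(1,2)]] assms(3)]) auto
qed

lemma summable_on_int_affine:
  fixes f :: "int \<Rightarrow> complex"
  assumes "f summable_on UNIV" "m \<noteq> 0"
  shows "(\<lambda>k. f (m * k + c)) summable_on UNIV"
proof -
  have "inj (\<lambda>k. m * k + c)" using assms(2) by (auto simp: inj_def)
  moreover have "f summable_on range (\<lambda>k. m * k + c)"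
    using summable_on_subset_banach[OF assms(1)] by blast
  ultimately show ?thesis using summable_on_reindex[of "\<lambda>k. m * k + c" UNIV f] by (simp add: o_def)
qed

lemma has_sum_int_shift:
  fixes f :: "int \<Rightarrow> 'a :: {topological_comm_monoid_add, t2_space}"
  shows "((\<lambda>k. f (k + c)) has_sum S) UNIV \<longleftrightarrow> (f has_sum S) UNIV"
  by (rule has_sum_reindex_bij_witness[of _ "\<lambda>k. k - c" "\<lambda>k. k + c"]) auto

lemma has_sum_int_reflect:
  fixes f :: "int \<Rightarrow> 'a :: {topological_comm_monoid_add, t2_space}"
  shows "((\<lambda>k. f (c - k)) has_sum S) UNIV \<longleftrightarrow> (f has_sum S) UNIV"
  by (rule has_sum_reindex_bij_witness[of _ "\<lambda>k. c - k" "\<lambda>k. c - k"]) auto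

lemma has_sum_diff:
  fixes f g :: "'a \<Rightarrow> complex"
  assumes "(f has_sum A) S" "(g has_sum B) S"
  shows "((\<lambda>k. f k - g k) has_sum (A - B)) S"
  using has_sum_add[OF assms(1) has_sum_uminusI[OF assms(2)]] by simp

text \<open>Cauchy product over the integers. Summability in the sense of \<open>has_sum\<close> is
  absolute for complex terms, so the double family \<open>a i * b j\<close> is summable and may be
  summed along the lines \<open>i + j = N\<close>.\<close>

lemma has_sum_int_convolution:
  fixes a b :: "int \<Rightarrow> complex"
  assumes a: "(a has_sum A) UNIV" and b: "(b has_sum B) UNIV"
  shows "(\<lambda>k. a k * b (N - k)) summable_on UNIV"
    and "((\<lambda>N. \<Sum>\<^sub>\<infinity>k. a k * b (N - k)) has_sum (A * B)) UNIV"
proof -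
  have sa: "(\<lambda>k. norm (a k)) summable_on UNIV" and sb: "(\<lambda>k. norm (b k)) summable_on UNIV"
    using a b summable_on_iff_abs_summable_on_complex unfolding summable_on_def by blast+
  have "(\<lambda>(i, j). norm (a i) * norm (b j)) summable_on UNIV \<times> UNIV"
  proof (rule summable_on_SigmaI)
    show "((\<lambda>y. case (i, y) of (i, j) \<Rightarrow> norm (a i) * norm (b j)) has_sum
        norm (a i) * infsum (\<lambda>j. norm (b j)) UNIV) UNIV" for i
      using has_sum_cmult_right[OF has_sum_infsum[OF sb]] by simp
    show "(\<lambda>i. norm (a i) * infsum (\<lambda>j. norm (b j)) UNIV) summable_on UNIV"
      by (rule summable_on_cmult_left[OF sa])
  qed auto
  then have s: "(\<lambda>(i, j). a i * b j) summable_on UNIV \<times> UNIV"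
    using abs_summable_summable[of "\<lambda>(i, j). a i * b j"] by (simp add: case_prod_unfold norm_mult)
  have "((\<lambda>(i, j). a i * b j) has_sum (A * B)) (UNIV \<times> UNIV)"
  proof -
    obtain S where S: "((\<lambda>(i, j). a i * b j) has_sum S) (UNIV \<times> UNIV)" using s unfolding summable_on_def by blast
    have "((\<lambda>i. a i * B) has_sum S) UNIV"
      by (rule has_sum_SigmaD[OF S]) (auto intro!: has_sum_cmult_right b)
    moreover have "((\<lambda>i. a i * B) has_sum (A * B)) UNIV" by (rule has_sum_cmult_left[OF a])
    ultimately show ?thesis using S has_sum_unique by blast
  qed
  then have h: "((\<lambda>(N, k). a k * b (N - k)) has_sum (A * B)) (UNIV \<times> UNIV)"
    by (subst has_sum_reindex_bij_witness[of _ "\<lambda>(i, j). (i + j, i)" "\<lambda>(N, k). (k, N - k)" _ "\<lambda>(i, j). a i * b j"]) auto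
  then have s': "(\<lambda>(N, k). a k * b (N - k)) summable_on (UNIV \<times> UNIV)" unfolding summable_on_def by blast
  have t: "(\<lambda>k. a k * b (N - k)) summable_on UNIV" for N
    using summable_on_SigmaD1[of "\<lambda>N k. a k * b (N - k)" UNIV "\<lambda>_. UNIV" N] s' by auto
  then show "(\<lambda>k. a k * b (N - k)) summable_on UNIV" .
  show "((\<lambda>N. \<Sum>\<^sub>\<infinity>k. a k * b (N - k)) has_sum (A * B)) UNIV"
    by (rule has_sum_SigmaD[OF h]) (use t in auto)
qed

text \<open>Enumerating the integers turns an unordered sum into an ordinary series, the form needed
  for Tannery's theorem and for termwise differentiation.\<close>

lemma has_sum_int_decode:
  fixes f :: "int \<Rightarrow> complex"
  assumes "(f has_sum S) UNIV"
  shows "(\<lambda>n. f (int_decode n)) sums S"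
  by (rule has_sum_imp_sums, subst has_sum_reindex_bij_betw[OF bij_int_decode]) (rule assms)

lemma tendsto_infsum_int_dominated:
  fixes f :: "'b \<Rightarrow> int \<Rightarrow> complex" and h :: "int \<Rightarrow> real"
  assumes lim: "\<And>k. ((\<lambda>n. f n k) \<longlongrightarrow> g k) F"
    and bound: "\<forall>\<^sub>F n in F. \<forall>k. norm (f n k) \<le> h k"
    and h: "h summable_on UNIV" and F: "F \<noteq> bot"
  shows "g summable_on UNIV" "((\<lambda>n. \<Sum>\<^sub>\<infinity>k. f n k) \<longlongrightarrow> (\<Sum>\<^sub>\<infinity>k. g k)) F"
proof -
  have gb: "norm (g k) \<le> h k" for k
    by (rule tendsto_upperbound[OF tendsto_norm[OF lim] _ F])
       (use bound in \<open>auto elim: eventually_mono\<close>)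
  have sg: "g summable_on UNIV"
    by (rule abs_summable_summable, rule summable_on_comparison_test[OF h gb]) auto
  have eqg: "(\<Sum>n. g (int_decode n)) = (\<Sum>\<^sub>\<infinity>k. g k)"
    using has_sum_int_decode[OF has_sum_infsum[OF sg]] by (simp add: sums_iff)
  have eqf: "\<forall>\<^sub>F n in F. (\<Sum>i. f n (int_decode i)) = (\<Sum>\<^sub>\<infinity>k. f n k)"
    using bound
  proof eventually_elim
    case (elim n)
    have "f n summable_on UNIV"
      by (rule abs_summable_summable, rule summable_on_comparison_test[OF h]) (use elim in auto)
    then show ?case using has_sum_int_decode[OF has_sum_infsum] by (simp add: sums_iff)
  qed
  have sh: "summable (\<lambda>n. h (int_decode n))"
    by (rule summable_on_imp_summable, subst summable_on_reindex_bij_betw[OF bij_int_decode]) (rule h)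
  have "eventually (\<lambda>(i, n). norm (f n (int_decode i)) \<le> h (int_decode i)) (at_top \<times>\<^sub>F F)"
    unfolding eventually_prod_filter
    by (rule exI[of _ "\<lambda>_. True"], rule exI[of _ "\<lambda>n. \<forall>k. norm (f n k) \<le> h k"]) (use bound in auto)
  from tannerys_theorem[OF lim this sh F]
  have "((\<lambda>n. \<Sum>i. f n (int_decode i)) \<longlongrightarrow> (\<Sum>i. g (int_decode i))) F" by blast
  then show "((\<lambda>n. \<Sum>\<^sub>\<infinity>k. f n k) \<longlongrightarrow> (\<Sum>\<^sub>\<infinity>k. g k)) F"
    unfolding eqg using Lim_transform_eventually[OF _ eqf] by blast
  show "g summable_on UNIV" by (fact sg)
qed

subsection \<open>Infinite products\<close>

definition qpoch :: "complex \<Rightarrow> complex \<Rightarrow> complex" where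
  "qpoch a q = (\<Prod>n. 1 - a * q ^ n)"

lemma convergent_prod_qpoch:
  fixes a q :: complex
  assumes "norm q < 1"
  shows "convergent_prod (\<lambda>n. 1 - a * q ^ n)"
proof -
  have "summable (\<lambda>n. norm a * norm q ^ n)"
    using assms by (intro summable_mult summable_geometric) auto
  then have "summable (\<lambda>n. norm (1 - a * q ^ n - 1))" by (simp add: norm_mult norm_power)
  then show ?thesis
    by (intro abs_convergent_prod_imp_convergent_prod summable_imp_abs_convergent_prod)
qed

lemma qpoch_LIMSEQ:
  assumes "norm q < 1"
  shows "(\<lambda>n. \<Prod>i<n. 1 - a * q ^ i) \<longlonglongrightarrow> qpoch a q"
  unfolding qpoch_def
  by (rule has_prod_imp_tendsto'[OF convergent_prod_has_prod[OF convergent_prod_qpoch[OF assms]]])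

lemma qpoch_nonzero:
  assumes "norm q < 1" "norm a < 1"
  shows "qpoch a q \<noteq> 0"
  unfolding qpoch_def
proof (rule prodinf_nonzero[OF convergent_prod_qpoch[OF assms(1)]])
  fix n
  have "norm (a * q ^ n) \<le> norm a * 1" unfolding norm_mult norm_power
    using assms by (intro mult_left_mono power_le_one) auto
  then show "1 - a * q ^ n \<noteq> 0" using assms by (metis mult.right_neutral norm_one not_less right_minus_eq)
qed

lemma euler_phi_conv_qpoch: "euler_phi q = qpoch q q"
  by (simp add: euler_phi_def qpoch_def)

lemma euler_phi_nonzero: "norm q < 1 \<Longrightarrow> euler_phi q \<noteq> 0"
  by (simp add: euler_phi_conv_qpoch qpoch_nonzero)

lemma qpoch_rec:
  assumes "norm q < 1"
  shows "qpoch a q = (1 - a) * qpoch (a * q) q"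
proof (rule LIMSEQ_unique)
  show "(\<lambda>n. \<Prod>i<Suc n. 1 - a * q ^ i) \<longlonglongrightarrow> qpoch a q"
    by (rule LIMSEQ_Suc[OF qpoch_LIMSEQ[OF assms]])
  have "(\<Prod>i<Suc n. 1 - a * q ^ i) = (1 - a) * (\<Prod>i<n. 1 - (a * q) * q ^ i)" for n
    by (subst prod.lessThan_Suc_shift) (simp add: mult.assoc)
  then show "(\<lambda>n. \<Prod>i<Suc n. 1 - a * q ^ i) \<longlonglongrightarrow> (1 - a) * qpoch (a * q) q"
    using tendsto_mult_left[OF qpoch_LIMSEQ[OF assms]] by presburger
qed

lemma qpoch_mult_uminus:
  assumes "norm q < 1"
  shows "qpoch a q * qpoch (- a) q = qpoch (a ^ 2) (q ^ 2)"
proof -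
  have "(1 - a * q ^ n) * (1 - (- a) * q ^ n) = 1 - a ^ 2 * (q ^ 2) ^ n" for n
    by (simp add: algebra_simps power2_eq_square flip: power_mult_distrib)
  then show ?thesis
    unfolding qpoch_def
    using prodinf_mult[OF convergent_prod_qpoch[OF assms, of a] convergent_prod_qpoch[OF assms, of "- a"]]
    by presburger
qed

lemma qpoch_bisect:
  assumes "norm q < 1"
  shows "qpoch a q = qpoch a (q ^ 2) * qpoch (a * q) (q ^ 2)"
proof (rule LIMSEQ_unique)
  have q2: "norm (q ^ 2) < 1" using assms by (simp add: norm_power power_less_one_iff)
  have "filterlim (\<lambda>n::nat. 2 * n) at_top sequentially"
    by (rule filterlim_subseq) (simp add: strict_mono_def)
  from filterlim_compose[OF qpoch_LIMSEQ[OF assms] this]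
  show "(\<lambda>n. \<Prod>i<2 * n. 1 - a * q ^ i) \<longlonglongrightarrow> qpoch a q" .
  have "(\<Prod>i<2 * n. 1 - a * q ^ i)
      = (\<Prod>i<n. 1 - a * (q ^ 2) ^ i) * (\<Prod>i<n. 1 - (a * q) * (q ^ 2) ^ i)" for n
    by (induction n) (auto simp: power_mult mult.assoc algebra_simps simp flip: power_mult)
  then show "(\<lambda>n. \<Prod>i<2 * n. 1 - a * q ^ i) \<longlonglongrightarrow> qpoch a (q ^ 2) * qpoch (a * q) (q ^ 2)"
    using tendsto_mult[OF qpoch_LIMSEQ[OF q2] qpoch_LIMSEQ[OF q2]] by presburger
qed

lemma continuous_on_qpoch:
  assumes "norm q < 1"
  shows "continuous_on (cball 0 r) (\<lambda>a. qpoch a q)"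
proof -
  have "uniformly_convergent_on (cball 0 r) (\<lambda>N a. \<Prod>n<N. 1 - a * q ^ n)"
  proof (rule uniformly_convergent_on_prod')
    show "uniformly_convergent_on (cball 0 r) (\<lambda>N a. \<Sum>n<N. norm (1 - a * q ^ n - 1))"
    proof (rule Weierstrass_m_test'[of _ _ "\<lambda>n. \<bar>r\<bar> * norm q ^ n"])
      show "summable (\<lambda>n. \<bar>r\<bar> * norm q ^ n)"
        using assms by (intro summable_mult summable_geometric) auto
      show "norm (norm (1 - a * q ^ n - 1)) \<le> \<bar>r\<bar> * norm q ^ n" if "a \<in> cball 0 r" for n a
        using that by (auto simp: norm_mult norm_power intro!: mult_right_mono)
    qed
  qed (auto intro!: continuous_intros)
  then obtain l where l: "uniform_limit (cball 0 r) (\<lambda>N a. \<Prod>n<N. 1 - a * q ^ n) l sequentially"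
    unfolding uniformly_convergent_on_def by blast
  have "l a = qpoch a q" if "a \<in> cball 0 r" for a
    using LIMSEQ_unique[OF tendsto_uniform_limitI[OF l that] qpoch_LIMSEQ[OF assms]] .
  moreover have "continuous_on (cball 0 r) l"
    by (rule uniform_limit_theorem[OF _ l]) (auto intro!: continuous_intros always_eventually)
  ultimately show ?thesis by (metis (no_types, lifting) continuous_on_cong)
qed

lemma isCont_qpoch:
  assumes "norm q < 1"
  shows "isCont (\<lambda>a. qpoch a q) a"
  by (rule continuous_on_interior[OF continuous_on_qpoch[OF assms, of "norm a + 1"]]) simp

subsection \<open>The Jacobi triple product\<close>

text \<open>Jacobi's theta function with nome \<open>p\<close> and \<open>s = exp (2 i z)\<close>,
  as a Laurent series in \<open>s\<close>.\<close>

definition theta :: "complex \<Rightarrow> complex \<Rightarrow> complex" where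
  "theta p s = (\<Sum>\<^sub>\<infinity>k::int. p powi (k ^ 2) * s powi k)"

text \<open>The Gaussian factor beats the exponential one: once \<open>S * r ^ m < 1\<close>, only
  finitely many \<open>n\<close> need a crude bound. A geometric majorant suffices for every later
  use.\<close>

lemma theta_term_bound:
  fixes p s :: complex
  assumes "norm p < 1" "s \<noteq> 0"
  obtains K where "\<And>k::int. norm (p powi (k ^ 2) * s powi k) \<le> K * norm p ^ nat \<bar>k\<bar>"
proof -
  define r where "r = norm p"
  define S where "S = max (norm s) (inverse (norm s))"
  have S: "S > 0" using assms by (simp add: S_def less_max_iff_disj)
  have r: "0 \<le> r" "r < 1" using assms by (auto simp: r_def)
  have "(\<lambda>n. S * r ^ n) \<longlonglongrightarrow> S * 0"
    by (intro tendsto_intros LIMSEQ_power_zero) (use r in auto)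
  then have "eventually (\<lambda>n. S * r ^ n < 1) sequentially"
    by (rule order_tendstoD) auto
  then obtain m where m: "S * r ^ m < 1" by (auto simp: eventually_sequentially)
  define K where "K = (max S 1) ^ m"
  \<comment> \<open>Stated with one more factor \<open>S\<close>, to be used at \<open>j\<close>
    when \<open>n = Suc j\<close>: there \<open>n * n = j * j + n + j\<close>, so a full factor
    \<open>r ^ n\<close> splits off.\<close>
  have bd: "r ^ (n * n) * S ^ (Suc n) \<le> K * max S 1" for n
  proof (cases "n \<le> m")
    case True
    have "r ^ (n * n) * S ^ (Suc n) \<le> 1 * max S 1 ^ Suc n"
      using r S by (intro mult_mono power_le_one power_mono) auto
    also have "max S 1 ^ Suc n \<le> max S 1 ^ Suc m" using True by (intro power_increasing) auto
    finally show ?thesis by (simp add: K_def mult.commute)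
  next
    case False
    have "r ^ (n * n) * S ^ (Suc n) = (S * r ^ n) ^ n * S" by (simp add: power_mult power_mult_distrib)
    also have "S * r ^ n \<le> S * r ^ m" using False r S by (intro mult_left_mono power_decreasing) auto
    then have "S * r ^ n \<le> 1" using m by linarith
    then have "(S * r ^ n) ^ n * S \<le> 1 * max S 1" using r S
      by (intro mult_mono power_le_one) auto
    also have "1 * max S 1 \<le> K * max S 1" unfolding K_def by (intro mult_right_mono one_le_power) auto
    finally show ?thesis .
  qed
  have 1: "1 \<le> K * max S 1" unfolding K_def power_Suc2[symmetric] by (intro one_le_power) auto
  have main: "norm (p powi (k ^ 2) * s powi k) \<le> (K * max S 1) * r ^ nat \<bar>k\<bar>" for k :: int
  proof -
    define n where "n = nat \<bar>k\<bar>"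
    have k2: "k ^ 2 = int (n * n)" by (simp add: n_def power2_eq_square)
    have sk: "norm (s powi k) \<le> S ^ n"
    proof (cases "k \<ge> 0")
      case True
      then have "norm (s powi k) = norm s ^ n" by (simp add: power_int_def n_def norm_power)
      then show ?thesis by (auto simp: S_def intro!: power_mono)
    next
      case False
      then have "norm (s powi k) = inverse (norm s) ^ n" by (simp add: power_int_def n_def norm_power norm_inverse)
      then show ?thesis by (auto simp: S_def intro!: power_mono)
    qed
    have "norm (p powi (k ^ 2) * s powi k) \<le> r ^ (n * n) * S ^ n"
      unfolding k2 power_int_of_nat norm_mult norm_power using sk r by (simp add: r_def mult_left_mono)
    also have "\<dots> \<le> (K * max S 1) * r ^ n"
    proof (cases n)
      case 0 then show ?thesis using 1 by simp
    next
      case (Suc j)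
      have "r ^ (n * n) * S ^ n = (r ^ (j * j) * S ^ Suc j) * r ^ n * r ^ j"
        by (simp add: Suc power_add algebra_simps)
      also have "\<dots> \<le> (K * max S 1) * r ^ n * 1"
        using r S by (intro mult_mono bd power_le_one mult_nonneg_nonneg) (auto simp: K_def)
      finally show ?thesis by simp
    qed
    finally show ?thesis by (simp add: n_def)
  qed
  show ?thesis by (rule that[of "K * max S 1"]) (use main in \<open>simp add: r_def\<close>)
qed

lemma theta_summable:
  fixes p s :: complex
  assumes "norm p < 1" "s \<noteq> 0"
  shows "(\<lambda>k::int. p powi (k ^ 2) * s powi k) summable_on UNIV"
proof -
  obtain K where K: "\<And>k::int. norm (p powi (k ^ 2) * s powi k) \<le> K * norm p ^ nat \<bar>k\<bar>"
    using theta_term_bound[OF assms] by blast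
  show ?thesis by (rule summable_on_int_comparison[of "norm p" _ K 0]) (use assms K in auto)
qed

lemma theta_has_sum:
  assumes "norm p < 1" "s \<noteq> 0"
  shows "((\<lambda>k::int. p powi (k ^ 2) * s powi k) has_sum theta p s) UNIV"
  unfolding theta_def using theta_summable[OF assms] by (rule has_sum_infsum)

section \<open>Finite form of the triple product and its limit\<close>

definition qfact :: "complex \<Rightarrow> nat \<Rightarrow> complex" where
  "qfact q n = (\<Prod>i<n. 1 - q ^ Suc i)"

text \<open>Extending the reciprocal by 0 to negative indices makes the finite product a sum over
  all integers and lets \<open>qrfact_rec\<close> hold for every \<open>j\<close>, with both sides 0
  at \<open>j = 0\<close>.\<close>

definition qrfact :: "complex \<Rightarrow> int \<Rightarrow> complex" where
  "qrfact q j = (if j < 0 then 0 else 1 / qfact q (nat j))"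

lemma qrfact_rec:
  assumes "norm q < 1"
  shows "qrfact q (j - 1) = (1 - q powi j) * qrfact q j"
proof (cases "j \<ge> 1")
  case True
  define n where "n = nat (j - 1)"
  have n: "j = int (Suc n)" using True by (simp add: n_def)
  have "qrfact q (j - 1) = 1 / qfact q n" by (simp add: qrfact_def n)
  also have "\<dots> = (1 - q ^ Suc n) * (1 / (qfact q n * (1 - q ^ Suc n)))"
    using one_minus_power_nonzero[OF assms, of "Suc n"] by simp
  also have "qfact q n * (1 - q ^ Suc n) = qfact q (Suc n)" by (simp add: qfact_def)
  also have "1 / qfact q (Suc n) = qrfact q j" unfolding qrfact_def n by (simp del: of_nat_Suc)
  also have "q ^ Suc n = q powi j" unfolding n power_int_of_nat ..
  finally show ?thesis .
next
  case False
  then have "j < 0 \<or> j = 0" by auto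
  then show ?thesis by (auto simp: qrfact_def)
qed

text \<open>The coefficient is the Gaussian binomial of 2 n over n + k in base \<open>p ^ 2\<close>.
  In the induction the new factor is \<open>(1 + p ^ (4 * n + 2)) + s * p ^ (2 * n + 1) + p ^ (2 * n
  + 1) / s\<close>, so the new coefficients combine the old ones at \<open>k\<close>,
  \<open>k - 1\<close> and \<open>k + 1\<close>.\<close>

lemma finite_triple_product:
  assumes p: "norm p < 1" "p \<noteq> 0" and s: "s \<noteq> 0"
  shows "((\<lambda>k::int. qfact (p^2) (2 * n) * qrfact (p^2) (int n - k) * qrfact (p^2) (int n + k) * (p powi (k ^ 2) * s powi k))
     has_sum (\<Prod>i<n. (1 + s * p ^ (2 * i + 1)) * (1 + p ^ (2 * i + 1) / s))) UNIV"
proof (induction n)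
  case 0
  have "((\<lambda>k::int. qfact (p^2) (2 * 0) * qrfact (p^2) (int 0 - k) * qrfact (p^2) (int 0 + k) * (p powi (k ^ 2) * s powi k)) has_sum 1) {0}"
    by (rule has_sum_finiteI) (auto simp: qfact_def qrfact_def)
  then show ?case
    by (subst has_sum_cong_neutral[of "{0}" UNIV]) (auto simp: qrfact_def)
next
  case (Suc n)
  let ?q = "p ^ 2" and ?P = "\<Prod>i<n. (1 + s * p ^ (2 * i + 1)) * (1 + p ^ (2 * i + 1) / s)"
  let ?c = "\<lambda>n k::int. qfact ?q (2 * n) * qrfact ?q (int n - k) * qrfact ?q (int n + k)"
  let ?t = "\<lambda>k::int. p powi (k ^ 2) * s powi k"
  have q: "norm ?q < 1" using p by (simp add: norm_power power_less_one_iff)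
  have q0: "?q \<noteq> 0" using p by simp
  note h = Suc.IH
  have h1: "((\<lambda>k. ?c n (k - 1) * ?t (k - 1)) has_sum ?P) UNIV"
    using has_sum_int_shift[of "\<lambda>k. ?c n k * ?t k" "-1"] h by simp
  have h2: "((\<lambda>k. ?c n (k + 1) * ?t (k + 1)) has_sum ?P) UNIV"
    using has_sum_int_shift[of "\<lambda>k. ?c n k * ?t k" "1"] h by simp
  have "((\<lambda>k. (1 + p ^ (4 * n + 2)) * (?c n k * ?t k) + (s * p ^ (2 * n + 1) * (?c n (k - 1) * ?t (k - 1)) +
      p ^ (2 * n + 1) / s * (?c n (k + 1) * ?t (k + 1)))) has_sum
      ((1 + p ^ (4 * n + 2)) * ?P + (s * p ^ (2 * n + 1) * ?P + p ^ (2 * n + 1) / s * ?P))) UNIV"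
    by (intro has_sum_add has_sum_cmult_right h h1 h2)
  also have "(1 + p ^ (4 * n + 2)) * ?P + (s * p ^ (2 * n + 1) * ?P + p ^ (2 * n + 1) / s * ?P)
     = (\<Prod>i<Suc n. (1 + s * p ^ (2 * i + 1)) * (1 + p ^ (2 * i + 1) / s))"
  proof -
    have e: "p ^ (4 * n + 2) = p ^ (2 * n + 1) * p ^ (2 * n + 1)"
      by (simp only: power_add[symmetric]) (simp add: algebra_simps)
    have "(1 + s * c) * (1 + c / s) = (1 + c * c) + (s * c + c / s)" for c
      using s by (simp add: field_simps)
    then have "(1 + s * p ^ (2 * n + 1)) * (1 + p ^ (2 * n + 1) / s) = (1 + p ^ (4 * n + 2)) + (s * p ^ (2 * n + 1) + p ^ (2 * n + 1) / s)"
      unfolding e .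
    then show ?thesis by (simp only: prod.lessThan_Suc) (simp only: algebra_simps)
  qed
  also have "(\<lambda>k. (1 + p ^ (4 * n + 2)) * (?c n k * ?t k) + (s * p ^ (2 * n + 1) * (?c n (k - 1) * ?t (k - 1)) +
      p ^ (2 * n + 1) / s * (?c n (k + 1) * ?t (k + 1)))) = (\<lambda>k. ?c (Suc n) k * ?t k)"
  proof
    fix k :: int
    \<comment> \<open>In terms of \<open>a\<close> and \<open>b\<close>, all three contributions are
      multiples of \<open>R1 * R2\<close> times the \<open>k\<close>-th theta term, with
      \<open>a * b = ?q ^ (2 * n + 2)\<close>; what remains is a rational identity in
      \<open>a\<close>, \<open>b\<close> and \<open>?q\<close>.\<close>
    define a where "a = ?q powi (int n + 1 - k)"
    define b where "b = ?q powi (int n + 1 + k)"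
    define R1 where "R1 = qrfact ?q (int n + 1 - k)"
    define R2 where "R2 = qrfact ?q (int n + 1 + k)"
    have pp: "?q powi m = p powi (2 * m)" for m by (simp add: power_int_power)
    have aq: "?q powi (int n - k) = a / ?q" unfolding a_def using q0 power_int_diff[of ?q "int n + 1 - k" 1] by simp
    have bq: "?q powi (int n + k) = b / ?q" unfolding b_def using q0 power_int_diff[of ?q "int n + 1 + k" 1] by simp
    have ab: "?q ^ (2 * n + 2) = a * b"
    proof -
      have "int n + 1 - k + (int n + 1 + k) = int (2 * n + 2)" by simp
      then have "?q ^ (2 * n + 2) = ?q powi (int n + 1 - k + (int n + 1 + k))"
        by (simp only: power_int_of_nat)
      then show ?thesis unfolding a_def b_def using power_int_add[of ?q] q0 by presburger
    qed
    have ab1: "?q ^ (2 * n + 1) = a * b / ?q" unfolding ab[symmetric] using q0 by (simp add: power_add power2_eq_square)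
    have ab': "p ^ (4 * n + 2) = a * b / ?q" unfolding ab1[symmetric] power_mult[symmetric] by (simp add: algebra_simps)
    have r1: "qrfact ?q (int n - k) = (1 - a) * R1"
      using qrfact_rec[OF q, of "int n + 1 - k"] by (simp add: a_def R1_def)
    have r2: "qrfact ?q (int n + k) = (1 - b) * R2"
      using qrfact_rec[OF q, of "int n + 1 + k"] by (simp add: b_def R2_def algebra_simps)
    have r1': "qrfact ?q (int n - (k + 1)) = (1 - a / ?q) * ((1 - a) * R1)"
      using qrfact_rec[OF q, of "int n - k"] unfolding r1 aq by (simp add: diff_diff_eq)
    have r2': "qrfact ?q (int n + (k - 1)) = (1 - b / ?q) * ((1 - b) * R2)"
      using qrfact_rec[OF q, of "int n + k"] unfolding r2 bq by (simp add: add_diff_eq)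
    have r1'': "qrfact ?q (int n - (k - 1)) = R1" by (simp add: R1_def algebra_simps)
    have r2'': "qrfact ?q (int n + (k + 1)) = R2" by (simp add: R2_def algebra_simps)
    have t1: "s * p ^ (2 * n + 1) * ?t (k - 1) = a * ?t k"
    proof -
      have "s * s powi (k - 1) = s powi k" using s by (simp add: power_int_diff)
      moreover have "p ^ (2 * n + 1) * p powi ((k - 1) ^ 2) = a * p powi (k ^ 2)"
      proof -
        have "p ^ (2 * n + 1) * p powi ((k - 1) ^ 2) = p powi (int (2 * n + 1) + (k - 1) ^ 2)"
          using p by (simp only: power_int_add power_int_of_nat simp_thms)
        also have "int (2 * n + 1) + (k - 1) ^ 2 = 2 * (int n + 1 - k) + k ^ 2"
          by (simp add: power2_eq_square algebra_simps)
        also have "p powi \<dots> = a * p powi (k ^ 2)"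
          unfolding a_def pp using p by (simp only: power_int_add simp_thms)
        finally show ?thesis .
      qed
      ultimately show ?thesis by (metis (no_types, lifting) mult.assoc mult.left_commute)
    qed
    have t2: "p ^ (2 * n + 1) / s * ?t (k + 1) = b * ?t k"
    proof -
      have "s powi (k + 1) / s = s powi k" using s by (simp add: power_int_add)
      moreover have "p ^ (2 * n + 1) * p powi ((k + 1) ^ 2) = b * p powi (k ^ 2)"
      proof -
        have "p ^ (2 * n + 1) * p powi ((k + 1) ^ 2) = p powi (int (2 * n + 1) + (k + 1) ^ 2)"
          using p by (simp only: power_int_add power_int_of_nat simp_thms)
        also have "int (2 * n + 1) + (k + 1) ^ 2 = 2 * (int n + 1 + k) + k ^ 2"
          by (simp add: power2_eq_square algebra_simps)
        also have "p powi \<dots> = b * p powi (k ^ 2)"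
          unfolding b_def pp using p by (simp only: power_int_add simp_thms)
        finally show ?thesis .
      qed
      ultimately show ?thesis by (metis (no_types, lifting) mult.assoc mult.left_commute times_divide_eq_left times_divide_eq_right)
    qed
    have f: "qfact ?q (2 * Suc n) = qfact ?q (2 * n) * (1 - a * b / ?q) * (1 - a * b)"
    proof -
      have "qfact ?q (2 * Suc n) = qfact ?q (2 * n) * (1 - ?q ^ (2 * n + 1)) * (1 - ?q ^ (2 * n + 2))"
        by (simp add: qfact_def)
      then show ?thesis unfolding ab ab1 .
    qed
    have "(1 + p ^ (4 * n + 2)) * (?c n k * ?t k) + (s * p ^ (2 * n + 1) * (?c n (k - 1) * ?t (k - 1)) +
      p ^ (2 * n + 1) / s * (?c n (k + 1) * ?t (k + 1))) =
      (1 + p ^ (4 * n + 2)) * ?c n k * ?t k + ?c n (k - 1) * (s * p ^ (2 * n + 1) * ?t (k - 1)) +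
      ?c n (k + 1) * (p ^ (2 * n + 1) / s * ?t (k + 1))" by (simp only: ac_simps)
    also have "\<dots> = qfact ?q (2 * n) * R1 * R2 * ?t k * ((1 + a * b / ?q) * (1 - a) * (1 - b)
         + a * (1 - b) * (1 - b / ?q) + b * (1 - a) * (1 - a / ?q))"
      unfolding t1 t2 r1 r2 r1' r2' r1'' r2'' ab' by (simp only: algebra_simps)
    also have "(1 + a * b / ?q) * (1 - a) * (1 - b)
         + a * (1 - b) * (1 - b / ?q) + b * (1 - a) * (1 - a / ?q) = (1 - a * b / ?q) * (1 - a * b)"
      using p by (simp add: field_simps power2_eq_square)
    also have "qfact ?q (2 * n) * R1 * R2 * ?t k * ((1 - a * b / ?q) * (1 - a * b)) = ?c (Suc n) k * ?t k"
    proof -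
      have "int (Suc n) - k = int n + 1 - k" "int (Suc n) + k = int n + 1 + k" by auto
      then show ?thesis unfolding f R1_def R2_def by (simp only: ac_simps)
    qed
    finally show "(1 + p ^ (4 * n + 2)) * (?c n k * ?t k) + (s * p ^ (2 * n + 1) * (?c n (k - 1) * ?t (k - 1)) +
      p ^ (2 * n + 1) / s * (?c n (k + 1) * ?t (k + 1))) = ?c (Suc n) k * ?t k" .
  qed
  finally show ?case .
qed


lemma qfact_LIMSEQ:
  assumes "norm q < 1"
  shows "qfact q \<longlonglongrightarrow> euler_phi q"
  using qpoch_LIMSEQ[OF assms, of q] by (simp add: qfact_def[abs_def] euler_phi_conv_qpoch)

lemma qrfact_LIMSEQ:
  assumes "norm q < 1"
  shows "(\<lambda>n. qrfact q (int n + k)) \<longlonglongrightarrow> 1 / euler_phi q"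
proof -
  have "filterlim (\<lambda>n. nat (int n + k)) at_top sequentially"
    unfolding filterlim_at_top
  proof
    fix Z
    show "\<forall>\<^sub>F n in sequentially. Z \<le> nat (int n + k)"
      using eventually_ge_at_top[of "Z + nat \<bar>k\<bar>"] by eventually_elim auto
  qed
  from filterlim_compose[OF qfact_LIMSEQ[OF assms] this]
  have "(\<lambda>n. 1 / qfact q (nat (int n + k))) \<longlonglongrightarrow> 1 / euler_phi q"
    by (intro tendsto_intros euler_phi_nonzero assms)
  moreover have "\<forall>\<^sub>F n in sequentially. 1 / qfact q (nat (int n + k)) = qrfact q (int n + k)"
    by (auto simp: eventually_sequentially qrfact_def intro!: exI[of _ "nat \<bar>k\<bar>"])
  ultimately show ?thesis by (rule Lim_transform_eventually)
qed

lemma qrfact_bounded: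
  assumes "norm q < 1"
  obtains M where "\<And>j. norm (qrfact q j) \<le> M" "M > 0"
proof -
  have "Bseq (\<lambda>n. qrfact q (int n + 0))"
    by (rule convergent_imp_Bseq[OF convergentI[OF qrfact_LIMSEQ[OF assms]]])
  then obtain M where M: "M > 0" "\<And>n. norm (qrfact q (int n)) \<le> M" unfolding Bseq_def by auto
  have "norm (qrfact q j) \<le> M" for j
    using M(2)[of "nat j"] M(1) by (cases "j \<ge> 0") (auto simp: qrfact_def)
  then show ?thesis using that M(1) by blast
qed

text \<open>The limit of \<open>finite_triple_product\<close>. For fixed \<open>k\<close> the
  Gaussian binomial tends to \<open>1 / euler_phi (p ^ 2)\<close>; it is bounded in \<open>n\<close>
  and \<open>k\<close>, so the geometric bound on the theta terms dominates.\<close>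

theorem jacobi_triple_product:
  assumes p: "norm p < 1" "p \<noteq> 0" and s: "s \<noteq> 0"
  shows "theta p s = euler_phi (p ^ 2) * qpoch (- (s * p)) (p ^ 2) * qpoch (- (p / s)) (p ^ 2)"
proof -
  let ?q = "p ^ 2"
  have q: "norm ?q < 1" using p by (simp add: norm_power power_less_one_iff)
  let ?c = "\<lambda>n k::int. qfact ?q (2 * n) * qrfact ?q (int n - k) * qrfact ?q (int n + k)"
  let ?t = "\<lambda>k::int. p powi (k ^ 2) * s powi k"
  let ?P = "\<lambda>n. (\<Prod>i<n. (1 + s * p ^ (2 * i + 1)) * (1 + p ^ (2 * i + 1) / s))"
  obtain K where K: "\<And>k. norm (?t k) \<le> K * norm p ^ nat \<bar>k\<bar>" using theta_term_bound[OF p(1) s] by blast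
  obtain M where M: "\<And>j. norm (qrfact ?q j) \<le> M" "M > 0" using qrfact_bounded[OF q] by blast
  have "Bseq (qfact ?q)" by (rule convergent_imp_Bseq[OF convergentI[OF qfact_LIMSEQ[OF q]]])
  then obtain B where B: "B > 0" "\<And>n. norm (qfact ?q n) \<le> B" unfolding Bseq_def by auto
  let ?h = "\<lambda>k::int. B * M * M * (K * norm p ^ nat \<bar>k\<bar>)"
  have bound: "norm (?c n k * ?t k) \<le> ?h k" for n k
    unfolding norm_mult[of "?c n k"] unfolding norm_mult[of "_ * _" "qrfact _ _"] norm_mult[of "qfact _ _"]
    using B M by (intro mult_mono K) auto
  have h: "?h summable_on UNIV"
    using summable_on_int_power_geometric[of "norm p" 0] p(1)
    by (intro summable_on_cmult_right) auto
  have f2: "filterlim (\<lambda>n::nat. 2 * n) at_top sequentially"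
    by (rule filterlim_subseq) (simp add: strict_mono_def)
  have lim: "(\<lambda>n. ?c n k * ?t k) \<longlonglongrightarrow> euler_phi ?q * (1 / euler_phi ?q) * (1 / euler_phi ?q) * ?t k" for k
    using qrfact_LIMSEQ[OF q, of "- k"]
    by (intro tendsto_intros filterlim_compose[OF qfact_LIMSEQ[OF q] f2] qrfact_LIMSEQ[OF q]) simp
  have "(\<lambda>n. \<Sum>\<^sub>\<infinity>k. ?c n k * ?t k) \<longlonglongrightarrow> (\<Sum>\<^sub>\<infinity>k. euler_phi ?q * (1 / euler_phi ?q) * (1 / euler_phi ?q) * ?t k)"
    by (rule tendsto_infsum_int_dominated(2)[OF lim always_eventually h]) (use bound in auto)
  also have "(\<Sum>\<^sub>\<infinity>k. euler_phi ?q * (1 / euler_phi ?q) * (1 / euler_phi ?q) * ?t k) = theta p s / euler_phi ?q"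
    unfolding theta_def by (subst infsum_cmult_right') (use euler_phi_nonzero[OF q] in simp)
  also have "(\<lambda>n. \<Sum>\<^sub>\<infinity>k. ?c n k * ?t k) = ?P"
    by (rule ext, rule infsumI, rule finite_triple_product[OF p s])
  finally have l1: "?P \<longlonglongrightarrow> theta p s / euler_phi ?q" .
  have e: "?P n = (\<Prod>i<n. 1 - (- (s * p)) * ?q ^ i) * (\<Prod>i<n. 1 - (- (p / s)) * ?q ^ i)" for n
    unfolding prod.distrib[symmetric]
    by (intro prod.cong) (auto simp: power_mult[symmetric] power_add algebra_simps)
  have "?P \<longlonglongrightarrow> qpoch (- (s * p)) ?q * qpoch (- (p / s)) ?q"
    unfolding e by (intro tendsto_mult qpoch_LIMSEQ q)
  from LIMSEQ_unique[OF l1 this] show ?thesis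
    using euler_phi_nonzero[OF q] by (simp add: field_simps)
qed

text \<open>The product form of Ramanujan's psi, the sum of \<open>q ^ (n * (n + 1) div 2)\<close>
  over natural \<open>n\<close>; \<open>theta_self\<close> is this series summed over all integers,
  hence its factor 2.\<close>

definition psi :: "complex \<Rightarrow> complex" where
  "psi q = euler_phi (q ^ 2) ^ 2 / euler_phi q"

lemma qpoch_uminus_self:
  assumes "norm q < 1"
  shows "qpoch (- q) q = euler_phi (q ^ 2) / euler_phi q"
  using qpoch_mult_uminus[OF assms, of q] euler_phi_nonzero[OF assms]
  by (simp add: euler_phi_conv_qpoch field_simps)

lemma qpoch_odd:
  assumes "norm q < 1"
  shows "qpoch q (q ^ 2) = euler_phi q / euler_phi (q ^ 2)"
proof -
  have "norm (q ^ 2) < 1" using assms by (simp add: norm_power power_less_one_iff)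
  then show ?thesis
    using qpoch_bisect[OF assms, of q] euler_phi_nonzero
    by (simp add: euler_phi_conv_qpoch field_simps power2_eq_square)
qed

lemma qpoch_uminus_odd:
  assumes "norm q < 1"
  shows "qpoch (- q) (q ^ 2) = euler_phi (q ^ 2) ^ 2 / (euler_phi q * euler_phi (q ^ 4))"
proof -
  have q2: "norm (q ^ 2) < 1" and q4: "norm (q ^ 4) < 1" using assms by (simp_all add: norm_power power_less_one_iff)
  have "qpoch q (q ^ 2) * qpoch (- q) (q ^ 2) = qpoch (q ^ 2) (q ^ 4)"
    using qpoch_mult_uminus[OF q2, of q] by simp
  moreover have "qpoch (q ^ 2) (q ^ 4) = euler_phi (q ^ 2) / euler_phi (q ^ 4)"
    using qpoch_odd[OF q2] by simp
  ultimately show ?thesis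
    using euler_phi_nonzero[OF assms] euler_phi_nonzero[OF q2] euler_phi_nonzero[OF q4]
    unfolding qpoch_odd[OF assms] power2_eq_square[of "euler_phi _"] by (simp add: field_simps)
qed

lemma theta_1:
  assumes p: "norm p < 1" "p \<noteq> 0"
  shows "theta p 1 = euler_phi (p ^ 2) ^ 5 / (euler_phi p ^ 2 * euler_phi (p ^ 4) ^ 2)"
proof -
  have "theta p 1 = euler_phi (p ^ 2) * qpoch (- p) (p ^ 2) ^ 2"
    using jacobi_triple_product[OF p, of 1] by (simp add: power2_eq_square)
  then show ?thesis
    unfolding qpoch_uminus_odd[OF p(1)] by (simp add: power_mult_distrib power_divide flip: power_mult power_Suc)
qed

lemma theta_minus_1:
  assumes p: "norm p < 1" "p \<noteq> 0"
  shows "theta p (- 1) = euler_phi p ^ 2 / euler_phi (p ^ 2)"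
proof -
  have p2: "norm (p ^ 2) < 1" using p by (simp add: norm_power power_less_one_iff)
  have "theta p (- 1) = euler_phi (p ^ 2) * qpoch p (p ^ 2) ^ 2"
    using jacobi_triple_product[OF p, of "- 1"] by (simp add: power2_eq_square)
  then show ?thesis
    unfolding qpoch_odd[OF p(1)] using euler_phi_nonzero[OF p2] by (simp add: field_simps power2_eq_square)
qed

lemma theta_self:
  assumes p: "norm p < 1" "p \<noteq> 0"
  shows "theta p p = 2 * psi (p ^ 2)"
proof -
  have p2: "norm (p ^ 2) < 1" using p by (simp add: norm_power power_less_one_iff)
  have "theta p p = euler_phi (p ^ 2) * qpoch (- (p ^ 2)) (p ^ 2) * qpoch (- 1) (p ^ 2)"
    using jacobi_triple_product[OF p, of p] p by (simp add: power2_eq_square)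
  also have "qpoch (- 1) (p ^ 2) = 2 * qpoch (- (p ^ 2)) (p ^ 2)"
    using qpoch_rec[OF p2, of "- 1"] by simp
  finally show ?thesis
    unfolding qpoch_uminus_self[OF p2] psi_def using euler_phi_nonzero[OF p2] by (simp add: field_simps power2_eq_square)
qed

subsection \<open>Theta constants\<close>

lemma has_sum_int_parity:
  fixes f :: "int \<Rightarrow> complex"
  assumes "((\<lambda>k. f (2 * k)) has_sum A) UNIV" and "((\<lambda>k. f (2 * k + 1)) has_sum B) UNIV"
  shows "(f has_sum (A + B)) UNIV"
proof -
  have 1: "(f has_sum A) {k. even k}"
    by (rule iffD1[OF has_sum_reindex_bij_betw[of "\<lambda>k. 2 * k" UNIV "{k. even k}" f] assms(1)])
       (rule bij_betwI[of _ _ _ "\<lambda>k. k div 2"], auto)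
  have 2: "(f has_sum B) {k. odd k}"
    by (rule iffD1[OF has_sum_reindex_bij_betw[of "\<lambda>k. 2 * k + 1" UNIV "{k. odd k}" f] assms(2)])
       (rule bij_betwI[of _ _ _ "\<lambda>k. k div 2"], auto)
  have "{k. even k} \<union> {k. odd k} = (UNIV :: int set)" "{k. even k} \<inter> {k. odd k} = ({} :: int set)" by auto
  then show ?thesis using has_sum_Un_disjoint[OF 1 2] by simp
qed

text \<open>A sum over pairs of integers, sorted by their sum \<open>N\<close>. For
  \<open>N = 2 * M\<close> the pair is \<open>M + j\<close>, \<open>M - j\<close> and the exponent
  is \<open>2 * (M ^ 2 + j ^ 2)\<close>; for \<open>N = 2 * M + 1\<close> it is
  \<open>M + 1 + j\<close>, \<open>M - j\<close> with exponent
  \<open>1 + 2 * (M ^ 2 + M) + 2 * (j ^ 2 + j)\<close>. Both cases factor.\<close>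

lemma theta_square:
  assumes p: "norm p < 1" "p \<noteq> 0"
  shows "theta p 1 ^ 2 = theta (p ^ 2) 1 ^ 2 + p * theta (p ^ 2) (p ^ 2) ^ 2"
proof -
  let ?q = "p ^ 2"
  have q: "norm ?q < 1" "?q \<noteq> 0" using p by (simp_all add: norm_power power_less_one_iff)
  have qp: "?q powi m = p powi (2 * m)" for m by (simp add: power_int_power)
  define f where "f N = (\<Sum>\<^sub>\<infinity>k. p powi (k ^ 2) * p powi ((N - k) ^ 2))" for N :: int
  have t: "((\<lambda>k::int. p powi (k ^ 2)) has_sum theta p 1) UNIV"
    using theta_has_sum[OF p(1), of 1] by simp
  have 1: "(f has_sum (theta p 1 * theta p 1)) UNIV"
    unfolding f_def by (rule has_sum_int_convolution(2)[OF t t])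
  have add: "p powi a * p powi b = p powi (a + b)" for a b using p by (simp add: power_int_add)
  have "f (2 * M) = ?q powi (M ^ 2) * theta ?q 1" for M
    unfolding f_def
  proof (rule infsumI)
    have "((\<lambda>j::int. ?q powi (M ^ 2) * ?q powi (j ^ 2)) has_sum ?q powi (M ^ 2) * theta ?q 1) UNIV"
      using theta_has_sum[OF q(1), of 1] by (intro has_sum_cmult_right) simp
    moreover have "?q powi (M ^ 2) * ?q powi (j ^ 2) = p powi ((j + M) ^ 2) * p powi ((2 * M - (j + M)) ^ 2)" for j
      unfolding qp add by (rule arg_cong[of _ _ "(powi) p"]) (simp add: power2_eq_square algebra_simps)
    ultimately show "((\<lambda>k. p powi (k ^ 2) * p powi ((2 * M - k) ^ 2)) has_sum ?q powi (M ^ 2) * theta ?q 1) UNIV"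
      by (simp only: has_sum_int_shift[of "\<lambda>k. p powi (k ^ 2) * p powi ((2 * M - k) ^ 2)" M])
  qed
  moreover have "((\<lambda>M::int. ?q powi (M ^ 2) * theta ?q 1) has_sum (theta ?q 1 * theta ?q 1)) UNIV"
    using theta_has_sum[OF q(1), of 1] by (intro has_sum_cmult_left) simp
  ultimately have 2: "((\<lambda>M. f (2 * M)) has_sum (theta ?q 1 * theta ?q 1)) UNIV" by simp
  have "f (2 * M + 1) = p * (?q powi (M ^ 2) * ?q powi M) * theta ?q ?q" for M
    unfolding f_def
  proof (rule infsumI)
    have "((\<lambda>j::int. p * (?q powi (M ^ 2) * ?q powi M) * (?q powi (j ^ 2) * ?q powi j)) has_sum
        p * (?q powi (M ^ 2) * ?q powi M) * theta ?q ?q) UNIV"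
      using theta_has_sum[OF q] by (intro has_sum_cmult_right)
    moreover have "p * (?q powi (M ^ 2) * ?q powi M) * (?q powi (j ^ 2) * ?q powi j)
        = p powi ((j + (M + 1)) ^ 2) * p powi ((2 * M + 1 - (j + (M + 1))) ^ 2)" for j
    proof -
      have "p * (?q powi (M ^ 2) * ?q powi M) * (?q powi (j ^ 2) * ?q powi j)
        = p powi 1 * (?q powi (M ^ 2) * ?q powi M) * (?q powi (j ^ 2) * ?q powi j)" by simp
      also have "\<dots> = p powi ((j + (M + 1)) ^ 2) * p powi ((2 * M + 1 - (j + (M + 1))) ^ 2)"
        unfolding qp add by (rule arg_cong[of _ _ "(powi) p"]) (simp add: power2_eq_square algebra_simps)
      finally show ?thesis .
    qed
    ultimately show "((\<lambda>k. p powi (k ^ 2) * p powi ((2 * M + 1 - k) ^ 2)) has_sum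
        p * (?q powi (M ^ 2) * ?q powi M) * theta ?q ?q) UNIV"
      by (simp only: has_sum_int_shift[of "\<lambda>k. p powi (k ^ 2) * p powi ((2 * M + 1 - k) ^ 2)" "M + 1"])
  qed
  moreover have "((\<lambda>M::int. p * (?q powi (M ^ 2) * ?q powi M) * theta ?q ?q) has_sum (p * theta ?q ?q * theta ?q ?q)) UNIV"
    using theta_has_sum[OF q] by (intro has_sum_cmult_left has_sum_cmult_right)
  ultimately have 3: "((\<lambda>M. f (2 * M + 1)) has_sum (p * theta ?q ?q * theta ?q ?q)) UNIV" by simp
  show ?thesis
    using has_sum_unique[OF 1 has_sum_int_parity[OF 2 3]] by (simp add: power2_eq_square mult.assoc)
qed

lemma theta_uminus: "theta (- p) 1 = theta p (- 1)"
  unfolding theta_def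
proof (rule infsum_cong)
  fix k :: int
  have "(- p) powi (k ^ 2) = (- 1) powi (k ^ 2) * p powi (k ^ 2)"
    using power_int_mult_distrib[of "- 1" p "k ^ 2"] by simp
  moreover have "(- 1) powi (k ^ 2) = ((- 1) powi k :: complex)"
    by (cases "even k") auto
  ultimately show "(- p) powi (k ^ 2) * 1 powi k = p powi (k ^ 2) * (- 1) powi k" by simp
qed

text \<open>In classical notation theta_3^4 - theta_2^4 = theta_4^4 for the nome
  \<open>x ^ 2\<close>. Multiplying \<open>theta_square\<close> at \<open>x\<close> and at
  \<open>- x\<close> gives a difference of squares on the right, and the product formulas identify
  the left side.\<close>

lemma jacobi_quartic:
  assumes x: "norm x < 1" "x \<noteq> 0"
  shows "theta (x ^ 2) 1 ^ 4 - 16 * x ^ 2 * psi (x ^ 4) ^ 4 = theta (x ^ 2) (- 1) ^ 4"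
proof -
  have x2: "norm (x ^ 2) < 1" "x ^ 2 \<noteq> 0" and x4: "norm (x ^ 4) < 1"
    using x by (simp_all add: norm_power power_less_one_iff)
  have A: "theta x 1 ^ 2 = theta (x ^ 2) 1 ^ 2 + x * (2 * psi (x ^ 4)) ^ 2"
    using theta_square[OF x] theta_self[OF x2] by simp
  have B: "theta x (- 1) ^ 2 = theta (x ^ 2) 1 ^ 2 - x * (2 * psi (x ^ 4)) ^ 2"
    using theta_square[of "- x"] x theta_self[OF x2] by (simp add: theta_uminus)
  have C: "theta x 1 * theta x (- 1) = theta (x ^ 2) (- 1) ^ 2"
    unfolding theta_1[OF x] theta_minus_1[OF x] theta_minus_1[OF x2]
    using euler_phi_nonzero[OF x(1)] euler_phi_nonzero[OF x2(1)] euler_phi_nonzero[OF x4]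
    by (simp add: power_divide) (simp add: divide_simps; simp add: eval_nat_numeral)
  have "theta (x ^ 2) (- 1) ^ 4 = (theta x 1) ^ 2 * (theta x (- 1)) ^ 2"
    using C by (metis power_mult_distrib mult_2_right numeral_Bit0 power_add power2_eq_square)
  also have "\<dots> = theta (x ^ 2) 1 ^ 4 - 16 * x ^ 2 * psi (x ^ 4) ^ 4"
    unfolding A B by (simp add: algebra_simps eval_nat_numeral)
  finally show ?thesis by simp
qed

lemma theta_1_mult_psi:
  assumes "norm q < 1" "q \<noteq> 0"
  shows "theta q 1 * psi (q ^ 2) = psi q ^ 2"
proof -
  have q2: "norm (q ^ 2) < 1" and q4: "norm (q ^ 4) < 1"
    using assms by (simp_all add: norm_power power_less_one_iff)
  show ?thesis
    unfolding theta_1[OF assms] psi_def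
    using euler_phi_nonzero[OF assms(1)] euler_phi_nonzero[OF q2] euler_phi_nonzero[OF q4]
    by (simp add: power_divide) (simp add: divide_simps; simp add: eval_nat_numeral)
qed

subsection \<open>A bilateral Lambert series\<close>

text \<open>
  The Laurent coefficients of \<open>theta p (- t / p) * (\<Sum>k. t^k \<gamma>\<^sub>k)\<close> satisfy a first order recurrence, so
  this product is a multiple of \<open>theta p (- t)\<close>; the constant is found by letting \<open>t\<close> tend to 1.
\<close>

context
  fixes p :: complex and \<gamma> :: "int \<Rightarrow> complex"
  assumes p: "norm p < 1" "p \<noteq> 0"
  defines "\<gamma> \<equiv> \<lambda>k. 1 / (1 - p powi (2 * k + 1))"
begin

lemma odd_powi_neq_1: "p powi (2 * k + 1) \<noteq> 1"
proof
  assume "p powi (2 * k + 1) = 1"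
  then have "norm p powi (2 * k + 1) = 1" by (metis norm_one norm_power_int)
  then show False using p power_int_strict_decreasing[of 0 "2 * k + 1" "norm p"]
      power_int_strict_decreasing[of "2 * k + 1" 0 "norm p"]
    by (cases "2 * k + 1 > 0"; cases "2 * k + 1 = 0") (auto, presburger)
qed

lemma gamma_eq: "\<gamma> k = 1 + p powi (2 * k + 1) * \<gamma> k"
  using odd_powi_neq_1[of k] by (simp add: \<gamma>_def field_simps)

text \<open>\<open>\<gamma> k\<close> tends to 1 as \<open>k\<close> grows and to 0 in the other
  direction, so the step function is the right thing to subtract. For \<open>k = - n - 1\<close> the
  error is of size \<open>norm p ^ (2 * n + 1)\<close>, one power short of the stated rate; hence
  the factor \<open>1 / norm p\<close>.\<close>

lemma gamma_bound:
  "norm (\<gamma> k - of_bool (k \<ge> 0)) \<le> 1 / (norm p * (1 - norm p)) * (norm p ^ 2) ^ nat \<bar>k\<bar>"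
proof -
  have lower: "1 - norm p \<le> norm (1 - p ^ Suc n)" for n
  proof -
    have "norm p ^ Suc n \<le> norm p" using p power_decreasing[of 1 "Suc n" "norm p"] by simp
    then show ?thesis using norm_triangle_ineq2[of 1 "p ^ Suc n"] by (simp add: norm_power norm_mult)
  qed
  have frac: "norm (p ^ Suc n / (1 - p ^ Suc n)) \<le> norm p ^ Suc n / (1 - norm p)" for n
    unfolding norm_divide norm_power using lower[of n] p by (intro divide_left_mono) (auto intro!: mult_pos_pos)
  show ?thesis
  proof (cases "k \<ge> 0")
    case True
    then obtain n where n: "k = int n" using nonneg_int_cases by blast
    have e: "2 * k + 1 = int (Suc (2 * n))" by (simp add: n)
    have "\<gamma> k - of_bool (k \<ge> 0) = p ^ Suc (2 * n) / (1 - p ^ Suc (2 * n))"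
      using gamma_eq[of k] True unfolding e power_int_of_nat by (simp add: \<gamma>_def e power_int_of_nat del: of_nat_Suc power_Suc)
    then have "norm (\<gamma> k - of_bool (k \<ge> 0)) \<le> norm p ^ Suc (2 * n) / (1 - norm p)" using frac by metis
    also have "\<dots> \<le> norm p ^ (2 * n) / (norm p * (1 - norm p))"
    proof -
      have "norm p * norm p \<le> 1" using p by (simp add: mult_le_one)
      then have "norm p ^ (2 * n) * (norm p * norm p) \<le> norm p ^ (2 * n) * 1" by (intro mult_left_mono) auto
      then have "norm p ^ Suc (2 * n) * norm p \<le> norm p ^ (2 * n)" by (simp add: ac_simps)
      then have "norm p ^ Suc (2 * n) * norm p / (norm p * (1 - norm p)) \<le> norm p ^ (2 * n) / (norm p * (1 - norm p))"
        using p by (intro divide_right_mono) auto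
      then show ?thesis using p by simp
    qed
    finally show ?thesis by (simp add: n power_mult)
  next
    case False
    define n where "n = nat (- k - 1)"
    have n: "k = - int (Suc n)" using False by (simp add: n_def)
    have e: "2 * k + 1 = - int (Suc (2 * n))" by (simp add: n)
    have inv: "1 / (1 - inverse c) = - (c / (1 - c))" if "c \<noteq> 0" "1 - c \<noteq> 0" for c :: complex
      using that by (simp add: field_simps)
    have "\<gamma> k = - (p ^ Suc (2 * n) / (1 - p ^ Suc (2 * n)))"
      unfolding \<gamma>_def e power_int_minus power_int_of_nat
      by (rule inv) (use p one_minus_power_nonzero[of p "Suc (2 * n)"] in \<open>auto simp del: power_Suc\<close>)
    then have "\<gamma> k - of_bool (k \<ge> 0) = - (p ^ Suc (2 * n) / (1 - p ^ Suc (2 * n)))"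
      using False by simp
    then have "norm (\<gamma> k - of_bool (k \<ge> 0)) \<le> norm p ^ Suc (2 * n) / (1 - norm p)" using frac by (metis norm_minus_cancel)
    also have "\<dots> = 1 / (norm p * (1 - norm p)) * (norm p ^ 2) ^ Suc n"
      using p by (simp add: field_simps power_mult power2_eq_square)
    also have "Suc n = nat \<bar>k\<bar>" by (simp add: n)
    finally show ?thesis .
  qed
qed

lemma gamma_bounded: "norm (\<gamma> k) \<le> 1 / (norm p * (1 - norm p)) + 1"
proof -
  have "norm (\<gamma> k) \<le> norm (\<gamma> k - of_bool (k \<ge> 0)) + norm (of_bool (k \<ge> 0) :: complex)"
    using norm_triangle_ineq[of "\<gamma> k - of_bool (k \<ge> 0)" "of_bool (k \<ge> 0)"] by simp
  also have "\<dots> \<le> 1 / (norm p * (1 - norm p)) * 1 + 1"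
    using p by (intro add_mono order_trans[OF gamma_bound] mult_left_mono power_le_one) auto
  finally show ?thesis by simp
qed

text \<open>The decay like \<open>norm p\<close> to the power \<open>2 |k|\<close> leaves one factor
  \<open>norm p\<close> to the power \<open>|k|\<close> to pay for \<open>t powi k\<close>. The
  closed lower end of the annulus matters: the evaluation takes place at
  \<open>t = - p\<close>.\<close>

lemma lambert_remainder_bound:
  assumes "norm p \<le> norm t" "norm t < 1"
  shows "norm (t powi k * (\<gamma> k - of_bool (k \<ge> 0))) \<le> 1 / (norm p * (1 - norm p)) * norm p ^ nat \<bar>k\<bar>"
proof -
  define n where "n = nat \<bar>k\<bar>"
  have t: "norm (t powi k) * norm p ^ n \<le> 1"
  proof (cases "k \<ge> 0")
    case True
    then have "norm (t powi k) = norm t ^ n" by (simp add: power_int_def n_def norm_power)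
    then show ?thesis using assms p by (simp add: mult_le_one power_le_one)
  next
    case False
    then have "norm (t powi k) = inverse (norm t) ^ n" by (simp add: power_int_def n_def norm_power norm_inverse)
    then have "norm (t powi k) * norm p ^ n = (norm p / norm t) ^ n"
      by (simp add: field_simps power_mult_distrib power_inverse)
    also have "\<dots> \<le> 1" using assms p by (intro power_le_one) (auto simp: divide_le_eq)
    finally show ?thesis .
  qed
  have "norm (t powi k * (\<gamma> k - of_bool (k \<ge> 0))) \<le> norm (t powi k) * (1 / (norm p * (1 - norm p)) * (norm p ^ 2) ^ n)"
    unfolding norm_mult n_def by (intro mult_left_mono gamma_bound) auto
  also have "\<dots> = (1 / (norm p * (1 - norm p)) * norm p ^ n) * (norm (t powi k) * norm p ^ n)"
    by (simp add: power2_eq_square power_mult_distrib)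
  also have "\<dots> \<le> (1 / (norm p * (1 - norm p)) * norm p ^ n) * 1"
    using p by (intro mult_left_mono t) auto
  finally show ?thesis by (simp add: n_def)
qed

lemma lambert_remainder_summable:
  assumes "norm p \<le> norm t" "norm t < 1"
  shows "(\<lambda>k. t powi k * (\<gamma> k - of_bool (k \<ge> 0))) summable_on UNIV"
  by (rule summable_on_int_comparison[of "norm p" _ "1 / (norm p * (1 - norm p))" 0])
     (use p lambert_remainder_bound[OF assms] in auto)

text \<open>The step function contributes the geometric series, which isolates the pole at
  \<open>t = 1\<close>; the remainder stays bounded as \<open>t\<close> approaches 1.\<close>

lemma bilateral_lambert_has_sum:
  assumes "norm p \<le> norm t" "norm t < 1"
  shows "((\<lambda>k. t powi k * \<gamma> k) has_sum
      (1 / (1 - t) + (\<Sum>\<^sub>\<infinity>k. t powi k * (\<gamma> k - of_bool (k \<ge> 0))))) UNIV"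
proof -
  have "((\<lambda>n::nat. t ^ n) has_sum (1 / (1 - t))) UNIV"
    by (rule norm_summable_imp_has_sum) (use assms geometric_sums[of t] in \<open>auto simp: norm_power summable_geometric\<close>)
  then have "((\<lambda>k::int. t powi k * of_bool (k \<ge> 0)) has_sum (1 / (1 - t) + 0)) UNIV"
    by (intro has_sum_int_split) auto
  from has_sum_add[OF this has_sum_infsum[OF lambert_remainder_summable[OF assms]]]
  show ?thesis by (simp add: algebra_simps)
qed

definition lambert_coeff :: "int \<Rightarrow> complex" where
  "lambert_coeff N = (\<Sum>\<^sub>\<infinity>k. p powi (k ^ 2) * (- 1 / p) powi k * \<gamma> (N - k))"

lemma lambert_coeff_has_sum:
  "((\<lambda>k. p powi (k ^ 2) * (- 1 / p) powi k * \<gamma> (N - k)) has_sum lambert_coeff N) UNIV"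
  unfolding lambert_coeff_def
proof (rule has_sum_infsum, rule abs_summable_summable, rule summable_on_comparison_test)
  have "(\<lambda>k::int. p powi (k ^ 2) * (- 1 / p) powi k) summable_on UNIV"
    using p by (intro theta_summable) auto
  then have "(\<lambda>k::int. norm (p powi (k ^ 2) * (- 1 / p) powi k)) summable_on UNIV"
    by (subst (asm) summable_on_iff_abs_summable_on_complex)
  then show "(\<lambda>k::int. norm (p powi (k ^ 2) * (- 1 / p) powi k) * (1 / (norm p * (1 - norm p)) + 1)) summable_on UNIV"
    by (rule summable_on_cmult_left)
  show "norm (p powi (k ^ 2) * (- 1 / p) powi k * \<gamma> (N - k)) \<le>
      norm (p powi (k ^ 2) * (- 1 / p) powi k) * (1 / (norm p * (1 - norm p)) + 1)" for k
    unfolding norm_mult[of _ "\<gamma> (N - k)"] by (intro mult_left_mono gamma_bounded) auto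
qed auto

text \<open>One factor of the triple product vanishes. This removes the inhomogeneous term from the
  recurrence \<open>lambert_coeff_rec\<close>.\<close>

lemma theta_zero: "theta p (- 1 / p) = 0"
proof -
  have p2: "norm (p ^ 2) < 1" using p by (simp add: norm_power power_less_one_iff)
  show ?thesis
    using jacobi_triple_product[OF p, of "- 1 / p"] p qpoch_rec[OF p2, of 1] by simp
qed

text \<open>Shifting \<open>k\<close> multiplies the theta coefficient by
  \<open>- (p powi (2 * k))\<close>, and \<open>gamma_eq\<close> turns
  \<open>p powi (2 * k) * \<gamma> (N - 1 - k)\<close> into
  \<open>p powi (2 * k) + p powi (2 * N - 1) * \<gamma> (N - 1 - k)\<close>. The first part sums to
  \<open>theta p (- 1 / p) = 0\<close>, up to sign.\<close>

lemma lambert_coeff_rec: "lambert_coeff N = - (p powi (2 * N - 1)) * lambert_coeff (N - 1)"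
proof -
  let ?\<tau> = "\<lambda>k::int. p powi (k ^ 2) * (- 1 / p) powi k"
  have t: "(?\<tau> has_sum 0) UNIV" using theta_has_sum[OF p(1), of "- 1 / p"] p theta_zero by simp
  have t1: "((\<lambda>k. ?\<tau> (k + 1)) has_sum 0) UNIV" using t has_sum_int_shift[of ?\<tau> 1] by simp
  have step: "?\<tau> (k + 1) = - (p powi (2 * k)) * ?\<tau> k" for k
  proof -
    have "p powi ((k + 1) ^ 2) = p powi (k ^ 2 + 2 * k + 1)" by (rule arg_cong[of _ _ "(powi) p"]) (simp add: power2_eq_square algebra_simps)
    also have "\<dots> = p powi (k ^ 2) * p powi (2 * k) * p" using p by (simp add: power_int_add)
    finally show ?thesis using p by (simp add: power_int_add)
  qed
  have "((\<lambda>k. ?\<tau> (k + 1) * \<gamma> (N - (k + 1))) has_sum lambert_coeff N) UNIV"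
    using lambert_coeff_has_sum[of N] has_sum_int_shift[of "\<lambda>k. ?\<tau> k * \<gamma> (N - k)" 1] by blast
  moreover have "?\<tau> (k + 1) * \<gamma> (N - (k + 1)) = ?\<tau> (k + 1) + - (p powi (2 * N - 1)) * (?\<tau> k * \<gamma> (N - 1 - k))" for k
  proof -
    have gen: "- a * t * g = - a * t + - b * (t * g)" if "a * g = a + b * g" for a b g t :: complex
      using that by algebra
    have "p powi (2 * k) * p powi (2 * (N - 1 - k) + 1) = p powi (2 * N - 1)"
      using p by (subst power_int_add[symmetric]) (auto simp: algebra_simps)
    then have "p powi (2 * k) * \<gamma> (N - 1 - k) = p powi (2 * k) + p powi (2 * N - 1) * \<gamma> (N - 1 - k)"
      by (subst gamma_eq) (simp add: algebra_simps)
    then have "- (p powi (2 * k)) * ?\<tau> k * \<gamma> (N - 1 - k) = - (p powi (2 * k)) * ?\<tau> k + - (p powi (2 * N - 1)) * (?\<tau> k * \<gamma> (N - 1 - k))"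
      by (rule gen)
    then show ?thesis unfolding step by (simp add: diff_diff_eq add.commute)
  qed
  moreover have "((\<lambda>k. ?\<tau> (k + 1) + - (p powi (2 * N - 1)) * (?\<tau> k * \<gamma> (N - 1 - k))) has_sum
      (0 + - (p powi (2 * N - 1)) * lambert_coeff (N - 1))) UNIV"
    by (intro has_sum_add t1 has_sum_cmult_right lambert_coeff_has_sum)
  ultimately have "lambert_coeff N = 0 + - (p powi (2 * N - 1)) * lambert_coeff (N - 1)"
    by (simp only: has_sum_unique)
  then show ?thesis by simp
qed

lemma lambert_coeff_eq: "lambert_coeff N = (- 1) powi N * p powi (N ^ 2) * lambert_coeff 0"
proof -
  let ?c = "\<lambda>N::int. (- 1) powi N * p powi (N ^ 2)"
  have c: "?c N = - (p powi (2 * N - 1)) * ?c (N - 1)" for N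
  proof -
    have "p powi (2 * N - 1) * p powi ((N - 1) ^ 2) = p powi (N ^ 2)"
      using p by (subst power_int_add[symmetric]) (auto simp: power2_eq_square algebra_simps)
    then show ?thesis by (simp add: power_int_diff)
  qed
  show ?thesis
  proof (induction N rule: int_induct[of _ 0])
    case base
    then show ?case by simp
  next
    case (step1 i)
    then show ?case using lambert_coeff_rec[of "i + 1"] c[of "i + 1"] by simp
  next
    case (step2 i)
    have "- (p powi (2 * i - 1)) * lambert_coeff (i - 1) = ?c i * lambert_coeff 0"
      using step2 lambert_coeff_rec[of i] by simp
    also have "\<dots> = - (p powi (2 * i - 1)) * (?c (i - 1) * lambert_coeff 0)"
      by (subst c) (simp only: mult.assoc)
    finally show ?case using p by simp
  qed
qed

lemma theta_mult_bilateral_lambert: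
  assumes t: "norm p \<le> norm t" "norm t < 1"
  shows "theta p (- t / p) * (1 / (1 - t) + (\<Sum>\<^sub>\<infinity>k. t powi k * (\<gamma> k - of_bool (k \<ge> 0)))) =
    lambert_coeff 0 * theta p (- t)"
proof -
  have t0: "t \<noteq> 0" using t p by auto
  have a: "((\<lambda>k::int. p powi (k ^ 2) * (- t / p) powi k) has_sum theta p (- t / p)) UNIV"
    using t0 p by (intro theta_has_sum) auto
  have "(\<Sum>\<^sub>\<infinity>k. (p powi (k ^ 2) * (- t / p) powi k) * (t powi (N - k) * \<gamma> (N - k))) = t powi N * lambert_coeff N" for N
  proof (rule infsumI)
    have "((\<lambda>k. t powi N * (p powi (k ^ 2) * (- 1 / p) powi k * \<gamma> (N - k))) has_sum t powi N * lambert_coeff N) UNIV"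
      by (intro has_sum_cmult_right lambert_coeff_has_sum)
    moreover have "t powi N * (p powi (k ^ 2) * (- 1 / p) powi k * \<gamma> (N - k)) = (p powi (k ^ 2) * (- t / p) powi k) * (t powi (N - k) * \<gamma> (N - k))" for k
    proof -
      have "t powi N = t powi k * t powi (N - k)" using t0 by (simp add: power_int_diff)
      moreover have "(- t / p) powi k = t powi k * (- 1 / p) powi k" by (subst power_int_mult_distrib[symmetric]) simp
      ultimately show ?thesis by (simp only: ac_simps)
    qed
    ultimately show "((\<lambda>k. (p powi (k ^ 2) * (- t / p) powi k) * (t powi (N - k) * \<gamma> (N - k))) has_sum t powi N * lambert_coeff N) UNIV"
      by (simp only:)
  qed
  with has_sum_int_convolution(2)[OF a bilateral_lambert_has_sum[OF t]]
  have 1: "((\<lambda>N. t powi N * lambert_coeff N) has_sum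
    (theta p (- t / p) * (1 / (1 - t) + (\<Sum>\<^sub>\<infinity>k. t powi k * (\<gamma> k - of_bool (k \<ge> 0)))))) UNIV" by simp
  have "((\<lambda>N::int. lambert_coeff 0 * (p powi (N ^ 2) * (- t) powi N)) has_sum lambert_coeff 0 * theta p (- t)) UNIV"
    using t0 p by (intro has_sum_cmult_right theta_has_sum) auto
  moreover have "lambert_coeff 0 * (p powi (N ^ 2) * (- t) powi N) = t powi N * lambert_coeff N" for N
    using power_int_mult_distrib[of "- 1" t N] by (subst lambert_coeff_eq) simp
  ultimately show ?thesis using has_sum_unique[OF 1] by simp
qed

text \<open>As \<open>t\<close> tends to 1 from the left, the zero \<open>1 - t\<close> of
  \<open>theta p (- t / p)\<close> cancels the pole of the Lambert series, and the bounded remainder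
  \<open>R\<close>, multiplied by \<open>1 - t\<close>, drops out. What remains on both sides are
  products of \<open>qpoch\<close>, which is continuous.\<close>

lemma lambert_coeff_0: "lambert_coeff 0 * theta p (- 1) = euler_phi (p ^ 2) ^ 3"
proof -
  let ?q = "p ^ 2"
  have q: "norm ?q < 1" using p by (simp add: norm_power power_less_one_iff)
  define R where "R t = (\<Sum>\<^sub>\<infinity>k. t powi k * (\<gamma> k - of_bool (k \<ge> 0)))" for t
  define M where "M = (\<Sum>\<^sub>\<infinity>k::int. 1 / (norm p * (1 - norm p)) * norm p ^ nat \<bar>k\<bar>)"
  have Rb: "norm (R t) \<le> M" if t: "norm p \<le> norm t" "norm t < 1" for t
  proof -
    have h: "(\<lambda>k::int. 1 / (norm p * (1 - norm p)) * norm p ^ nat \<bar>k\<bar>) summable_on UNIV"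
      using summable_on_int_power_geometric[of "norm p" 0] p by (intro summable_on_cmult_right) auto
    have "(\<lambda>k. norm (t powi k * (\<gamma> k - of_bool (k \<ge> 0)))) summable_on UNIV"
      by (rule summable_on_comparison_test[OF h lambert_remainder_bound[OF t]]) auto
    then have "norm (R t) \<le> (\<Sum>\<^sub>\<infinity>k. norm (t powi k * (\<gamma> k - of_bool (k \<ge> 0))))"
      unfolding R_def by (rule norm_infsum_bound)
    also have "\<dots> \<le> M" unfolding M_def
      by (rule infsum_mono[OF _ h]) (use lambert_remainder_bound[OF t] in \<open>auto intro!: summable_on_comparison_test[OF h]\<close>)
    finally show ?thesis .
  qed
  let ?F = "at_left (1::real)"
  have ev: "\<forall>\<^sub>F t in ?F. norm p < t \<and> t < 1"
    using p by (auto simp: eventually_at_left_field intro!: exI[of _ "norm p"])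
  have t1: "((\<lambda>t. complex_of_real t) \<longlongrightarrow> 1) ?F"
    by (rule tendsto_eq_intros refl | simp)+
  have qp: "((\<lambda>t. qpoch (f t) ?q) \<longlongrightarrow> qpoch l ?q) ?F" if "(f \<longlongrightarrow> l) ?F" for f l
    by (rule isCont_tendsto_compose[OF isCont_qpoch[OF q] that])
  have lim1: "((\<lambda>t. euler_phi ?q * qpoch (complex_of_real t * ?q) ?q * qpoch (?q / complex_of_real t) ?q *
        (1 + (1 - complex_of_real t) * R (complex_of_real t))) \<longlongrightarrow>
      euler_phi ?q * qpoch (1 * ?q) ?q * qpoch (?q / 1) ?q * (1 + 0)) ?F"
  proof (intro tendsto_mult tendsto_add tendsto_const qp t1 tendsto_divide)
    have "((\<lambda>t. (1 - complex_of_real t)) \<longlongrightarrow> 1 - 1) ?F" by (intro tendsto_intros t1)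
    then have z: "((\<lambda>t. (1 - complex_of_real t)) \<longlongrightarrow> 0) ?F" by simp
    have "((\<lambda>t. R (complex_of_real t) * (1 - complex_of_real t)) \<longlongrightarrow> 0) ?F"
    proof (rule Lim_null_comparison)
      show "\<forall>\<^sub>F t in ?F. norm (R (complex_of_real t) * (1 - complex_of_real t)) \<le> M * norm (1 - complex_of_real t)"
        using ev
      proof eventually_elim
        case (elim t)
        have "0 < t" using elim by (intro order_le_less_trans[OF norm_ge_zero[of p]]) auto
        then have "norm (complex_of_real t) = t" by simp
        then show ?case unfolding norm_mult using elim by (intro mult_right_mono Rb) auto
      qed
      show "((\<lambda>t. M * norm (1 - complex_of_real t)) \<longlongrightarrow> 0) ?F"
        using tendsto_mult_right_zero[OF tendsto_norm_zero[OF z]] .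
    qed
    then show "((\<lambda>t. (1 - complex_of_real t) * R (complex_of_real t)) \<longlongrightarrow> 0) ?F" by (simp add: mult.commute)
  qed auto
  have lim2: "((\<lambda>t. lambert_coeff 0 * (euler_phi ?q * qpoch (complex_of_real t * p) ?q * qpoch (p / complex_of_real t) ?q)) \<longlongrightarrow>
      lambert_coeff 0 * (euler_phi ?q * qpoch (1 * p) ?q * qpoch (p / 1) ?q)) ?F"
    by (intro tendsto_mult tendsto_const qp t1 tendsto_divide) auto
  have "\<forall>\<^sub>F t in ?F. euler_phi ?q * qpoch (complex_of_real t * ?q) ?q * qpoch (?q / complex_of_real t) ?q *
        (1 + (1 - complex_of_real t) * R (complex_of_real t))
      = lambert_coeff 0 * (euler_phi ?q * qpoch (complex_of_real t * p) ?q * qpoch (p / complex_of_real t) ?q)"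
    using ev
  proof eventually_elim
    case (elim t)
    let ?t = "complex_of_real t"
    have tpos: "0 < t" using elim by (intro order_le_less_trans[OF norm_ge_zero[of p]]) auto
    then have n: "norm ?t = t" by simp
    have t0: "?t \<noteq> 0" "?t \<noteq> 1" using elim tpos by auto
    have 1: "theta p (- ?t / p) = euler_phi ?q * ((1 - ?t) * qpoch (?t * ?q) ?q) * qpoch (?q / ?t) ?q"
      unfolding qpoch_rec[OF q, of ?t, symmetric]
      using jacobi_triple_product[OF p, of "- ?t / p"] t0 p by (simp add: power2_eq_square)
    have 2: "theta p (- ?t) = euler_phi ?q * qpoch (?t * p) ?q * qpoch (p / ?t) ?q"
      using jacobi_triple_product[OF p, of "- ?t"] t0 by simp
    have 3: "theta p (- ?t / p) * (1 / (1 - ?t) + R ?t) = lambert_coeff 0 * theta p (- ?t)"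
      unfolding R_def by (rule theta_mult_bilateral_lambert) (use elim n in auto)
    have 4: "(1 - ?t) * (1 / (1 - ?t) + R ?t) = 1 + (1 - ?t) * R ?t"
      using t0 by (simp add: field_simps)
    show ?case unfolding 4[symmetric] 2[symmetric] 3[symmetric] unfolding 1 by (simp only: ac_simps)
  qed
  from tendsto_unique[OF _ Lim_transform_eventually[OF lim1 this] lim2]
  have "euler_phi ?q * qpoch ?q ?q * qpoch ?q ?q = lambert_coeff 0 * (euler_phi ?q * qpoch p ?q * qpoch p ?q)"
    by simp
  moreover have "theta p (- 1) = euler_phi ?q * qpoch p ?q * qpoch p ?q"
    using jacobi_triple_product[OF p, of "- 1"] by simp
  ultimately have "lambert_coeff 0 * theta p (- 1) = euler_phi ?q * qpoch ?q ?q * qpoch ?q ?q"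
    by (simp only:)
  then show ?thesis by (simp only: euler_phi_conv_qpoch power3_eq_cube)
qed

text \<open>At \<open>t = - p\<close> the two theta factors are \<open>theta p 1\<close> and
  \<open>theta p p\<close>; multiplying by \<open>theta p (- 1)\<close> removes the unknown
  constant, and the rest is a cancellation of Euler functions.\<close>

lemma lambert_psi_gamma: "((\<lambda>k. (- p) powi k * \<gamma> k) has_sum 2 * psi (p ^ 2) ^ 2) UNIV"
proof -
  have p2: "norm (p ^ 2) < 1" and p4: "norm (p ^ 4) < 1" using p by (simp_all add: norm_power power_less_one_iff)
  define G where "G = 1 / (1 - (- p)) + (\<Sum>\<^sub>\<infinity>k. (- p) powi k * (\<gamma> k - of_bool (k \<ge> 0)))"
  have h: "((\<lambda>k. (- p) powi k * \<gamma> k) has_sum G) UNIV"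
    unfolding G_def by (rule bilateral_lambert_has_sum) (use p in auto)
  have "theta p 1 * G = lambert_coeff 0 * (2 * psi (p ^ 2))"
    using theta_mult_bilateral_lambert[of "- p"] p theta_self[OF p] by (simp add: G_def)
  then have "theta p 1 * theta p (- 1) * G = euler_phi (p ^ 2) ^ 3 * (2 * psi (p ^ 2))"
    unfolding lambert_coeff_0[symmetric] by (simp add: ac_simps)
  moreover have "theta p 1 * theta p (- 1) * psi (p ^ 2) = euler_phi (p ^ 2) ^ 3"
    unfolding theta_1[OF p] theta_minus_1[OF p] psi_def
    using euler_phi_nonzero[OF p(1)] euler_phi_nonzero[OF p2] euler_phi_nonzero[OF p4]
    by (simp add: divide_simps) (simp add: eval_nat_numeral)
  moreover have "theta p 1 * theta p (- 1) \<noteq> 0"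
    unfolding theta_1[OF p] theta_minus_1[OF p]
    using euler_phi_nonzero[OF p(1)] euler_phi_nonzero[OF p2] euler_phi_nonzero[OF p4] by simp
  ultimately have "theta p 1 * theta p (- 1) * G = theta p 1 * theta p (- 1) * (2 * psi (p ^ 2) ^ 2)"
    by (simp only: power2_eq_square) (metis mult.assoc mult.commute)
  then have "G = 2 * psi (p ^ 2) ^ 2" using \<open>theta p 1 * theta p (- 1) \<noteq> 0\<close> by simp
  then show ?thesis using h by simp
qed

end

lemma lambert_psi:
  assumes "norm p < 1" "p \<noteq> 0"
  shows "((\<lambda>k. (- p) powi k / (1 - p powi (2 * k + 1))) has_sum 2 * psi (p ^ 2) ^ 2) UNIV"
  using lambert_psi_gamma[OF assms] by simp

subsection \<open>The elliptic function\<close>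

text \<open>With \<open>x = exp (- t)\<close> this is 1 / (2 sinh (n t)). At \<open>n = 0\<close>
  division by zero gives 0, which keeps \<open>lcoef_bound\<close> true there.\<close>

definition lcoef :: "complex \<Rightarrow> int \<Rightarrow> complex" where
  "lcoef x n = 1 / (x powi (- n) - x powi n)"

text \<open>Weights \<open>n ^ j\<close> stand in for the \<open>j\<close>-th derivative, from which
  they differ by the factor i^j; this makes \<open>Phi x j 0\<close> the \<open>j\<close>-th moment
  of the odd coefficients.\<close>

definition Phi :: "complex \<Rightarrow> nat \<Rightarrow> complex \<Rightarrow> complex" where
  "Phi x j z = (\<Sum>\<^sub>\<infinity>k::int. of_int (2 * k + 1) ^ j * lcoef x (2 * k + 1) * exp (\<i> * of_int (2 * k + 1) * z))"

lemma lcoef_minus: "lcoef x (- n) = - lcoef x n"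
  using minus_divide_right[of 1 "x powi (- n) - x powi n"] by (simp add: lcoef_def)

lemma lcoef_0 [simp]: "lcoef x 0 = 0"
  by (simp add: lcoef_def)

lemma lcoef_power2: "lcoef (x ^ 2) n = lcoef x (2 * n)"
  by (simp add: lcoef_def power_int_power)

lemma mult_interchange:
  fixes a b c d e :: "'a :: ab_semigroup_mult"
  shows "c * d = e \<Longrightarrow> a * c * (b * d) = a * b * e"
  by (auto simp: ac_simps)

context
  fixes x :: complex
  assumes x: "norm x < 1" "x \<noteq> 0"
begin

lemma powi_eq_1_iff: "x powi n = 1 \<longleftrightarrow> n = 0"
proof
  assume "x powi n = 1"
  then have a: "norm x powi n = 1" by (metis norm_one norm_power_int)
  show "n = 0"
  proof (rule ccontr)
    assume "n \<noteq> 0"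
    then consider "0 < n" | "n < 0" by linarith
    then show False
    proof cases
      case 1
      then show False using power_int_strict_decreasing[of 0 n "norm x"] x a by simp
    next
      case 2
      then show False using power_int_strict_decreasing[of n 0 "norm x"] x a by simp
    qed
  qed
qed simp

lemma lcoef_denom_nonzero: "n \<noteq> 0 \<Longrightarrow> x powi (- n) - x powi n \<noteq> 0"
proof
  assume n: "n \<noteq> 0" and "x powi (- n) - x powi n = 0"
  then have "x powi n * x powi n = x powi n * x powi (- n)" by simp
  then have "x powi (n + n) = x powi (n + - n)" using x by (simp only: power_int_add simp_thms)
  then have "x powi (n + n) = 1" by simp
  then show False using n powi_eq_1_iff[of "n + n"] by simp
qed

lemma lcoef_nonzero: "n \<noteq> 0 \<Longrightarrow> lcoef x n \<noteq> 0"
  using lcoef_denom_nonzero by (simp add: lcoef_def)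

definition lcoth :: "int \<Rightarrow> complex" where
  "lcoth n = (x powi (- n) + x powi n) * lcoef x n"

lemma lcoth_minus: "lcoth (- n) = - lcoth n"
  by (simp add: lcoth_def lcoef_minus add.commute)

text \<open>With \<open>x = exp (- t)\<close>, this is \<open>csch a * csch b = csch (a + b) * (coth a + coth b)\<close>.\<close>

lemma lcoef_mult:
  assumes "i \<noteq> 0" "j \<noteq> 0" "i + j \<noteq> 0"
  shows "lcoef x i * lcoef x j = 1 / 2 * lcoef x (i + j) * (lcoth i + lcoth j)"
proof -
  define X where "X = x powi i"
  define Y where "Y = x powi j"
  have XY: "X \<noteq> 0" "Y \<noteq> 0" using x by (auto simp: X_def Y_def)
  have m: "x powi (- i) = inverse X" "x powi (- j) = inverse Y" "x powi (i + j) = X * Y"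
    using x by (simp_all add: X_def Y_def power_int_minus power_int_add)
  have m' : "x powi (- (i + j)) = inverse (X * Y)" by (simp only: power_int_minus m(3))
  have nz: "inverse X - X \<noteq> 0" "inverse Y - Y \<noteq> 0" "inverse (X * Y) - X * Y \<noteq> 0"
    using lcoef_denom_nonzero[OF assms(1)] lcoef_denom_nonzero[OF assms(2)] lcoef_denom_nonzero[OF assms(3)]
    unfolding m m' by (simp_all add: X_def Y_def)
  have id: "(inverse X + X) * (inverse Y - Y) + (inverse Y + Y) * (inverse X - X) = 2 * (inverse (X * Y) - X * Y)"
    using XY by (simp add: field_simps)
  have "1 / a * (1 / b) = 1 / 2 * (1 / c) * (a' * (1 / a) + b' * (1 / b))"
    if "a \<noteq> 0" "b \<noteq> 0" "c \<noteq> 0" "a' * b + b' * a = 2 * c" for a b c a' b' :: complex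
  proof -
    have "1 / 2 * (1 / c) * (a' * (1 / a) + b' * (1 / b)) = (a' * b + b' * a) / (2 * c * a * b)"
      using that(1-3) by (simp add: field_simps)
    then show ?thesis unfolding that(4) using that(1-3) by simp
  qed
  from this[OF nz id] show ?thesis
    unfolding lcoth_def lcoef_def m m' by (simp only: X_def[symmetric] Y_def[symmetric])
qed

section \<open>Convergence in a strip and termwise differentiation\<close>

lemma lcoef_bound: "norm (lcoef x n) \<le> 1 / (1 - norm x) * norm x ^ nat \<bar>n\<bar>"
proof -
  have pos: "norm (lcoef x (int (Suc m))) \<le> 1 / (1 - norm x) * norm x ^ Suc m" for m
  proof -
    have e: "lcoef x (int (Suc m)) = x ^ Suc m / (1 - x ^ Suc m * x ^ Suc m)"
      unfolding lcoef_def power_int_minus power_int_of_nat using x by (simp add: field_simps)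
    have "norm x ^ Suc m * norm x ^ Suc m \<le> norm x ^ 1 * 1"
      using x by (intro mult_mono power_decreasing power_le_one) auto
    then have "1 - norm x \<le> norm (1 - x ^ Suc m * x ^ Suc m)"
      using norm_triangle_ineq2[of 1 "x ^ Suc m * x ^ Suc m"] by (simp add: norm_mult norm_power)
    then have "norm x ^ Suc m / norm (1 - x ^ Suc m * x ^ Suc m) \<le> norm x ^ Suc m / (1 - norm x)"
      using x by (intro divide_left_mono) (auto intro!: mult_pos_pos)
    then show ?thesis unfolding e norm_divide norm_power by simp
  qed
  show ?thesis
  proof (cases n "0::int" rule: linorder_cases)
    case less
    then have "n = - int (Suc (nat (- n - 1)))" by simp
    then show ?thesis using pos[of "nat (- n - 1)"] by (metis lcoef_minus norm_minus_cancel abs_minus_cancel abs_of_nat nat_int)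
  next
    case equal
    then show ?thesis using x by simp
  next
    case greater
    then have "n = int (Suc (nat (n - 1)))" by simp
    then show ?thesis using pos[of "nat (n - 1)"] by (metis abs_of_nat nat_int)
  qed
qed

text \<open>The decay of the coefficients competes with the growth of the exponentials, so the
  series converges where \<open>norm x * exp \<bar>Im z\<bar> < 1\<close>. Allowing any larger
  \<open>r\<close> makes the bound uniform on a narrower strip.\<close>

lemma fourier_term_bound:
  assumes "norm x * exp \<bar>Im z\<bar> \<le> r"
  shows "norm (of_int n ^ j * lcoef x n * exp (\<i> * of_int n * z)) \<le> 1 / (1 - norm x) * (\<bar>of_int n\<bar> ^ j * r ^ nat \<bar>n\<bar>)"
proof -
  have "\<bar>real_of_int n\<bar> = real (nat \<bar>n\<bar>)" by simp
  then have "norm (exp (\<i> * of_int n * z)) \<le> exp (real (nat \<bar>n\<bar>) * \<bar>Im z\<bar>)"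
    using abs_ge_minus_self[of "real_of_int n * Im z"] by (simp add: norm_exp_eq_Re abs_mult)
  also have "\<dots> = exp \<bar>Im z\<bar> ^ nat \<bar>n\<bar>" by (rule exp_of_nat_mult)
  finally have e: "norm (exp (\<i> * of_int n * z)) \<le> exp \<bar>Im z\<bar> ^ nat \<bar>n\<bar>" .
  have "norm (of_int n ^ j * lcoef x n * exp (\<i> * of_int n * z)) \<le>
     \<bar>of_int n\<bar> ^ j * (1 / (1 - norm x) * norm x ^ nat \<bar>n\<bar>) * exp \<bar>Im z\<bar> ^ nat \<bar>n\<bar>"
    unfolding norm_mult norm_power norm_of_int using x by (intro mult_mono e lcoef_bound) auto
  also have "\<dots> = 1 / (1 - norm x) * (\<bar>of_int n\<bar> ^ j * (norm x * exp \<bar>Im z\<bar>) ^ nat \<bar>n\<bar>)"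
    by (simp add: power_mult_distrib)
  also have "\<dots> \<le> 1 / (1 - norm x) * (\<bar>of_int n\<bar> ^ j * r ^ nat \<bar>n\<bar>)"
    using x assms by (intro mult_left_mono power_mono) auto
  finally show ?thesis .
qed

lemma fourier_summable:
  assumes "norm x * exp \<bar>Im z\<bar> < 1"
  shows "(\<lambda>n::int. of_int n ^ j * lcoef x n * exp (\<i> * of_int n * z)) summable_on UNIV"
  by (rule summable_on_int_comparison[of "norm x * exp \<bar>Im z\<bar>" _ "1 / (1 - norm x)" j])
     (use assms fourier_term_bound[OF order_refl] in auto)

lemma Phi_has_sum:
  assumes "norm x * exp \<bar>Im z\<bar> < 1"
  shows "((\<lambda>k::int. of_int (2 * k + 1) ^ j * lcoef x (2 * k + 1) * exp (\<i> * of_int (2 * k + 1) * z)) has_sum Phi x j z) UNIV"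
  unfolding Phi_def
  by (rule has_sum_infsum) (use summable_on_int_affine[OF fourier_summable[OF assms, of j], where m = 2 and c = 1] in simp)

lemma Phi_has_sum_0: "((\<lambda>k::int. of_int (2 * k + 1) ^ j * lcoef x (2 * k + 1)) has_sum Phi x j 0) UNIV"
  using Phi_has_sum[of 0 j] x by simp

text \<open>The coefficients are odd in \<open>n\<close> and \<open>n ^ j\<close> is even, so
  reflecting \<open>n\<close>, that is \<open>k\<close> to \<open>- 1 - k\<close>, negates the
  sum.\<close>

lemma Phi_even_0:
  assumes "even j"
  shows "Phi x j 0 = 0"
proof -
  let ?f = "\<lambda>k::int. of_int (2 * k + 1) ^ j * lcoef x (2 * k + 1)"
  have "((\<lambda>k. ?f (- 1 - k)) has_sum Phi x j 0) UNIV"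
    using Phi_has_sum_0[of j] has_sum_int_reflect[of ?f "- 1"] by blast
  moreover have "?f (- 1 - k) = - ?f k" for k
  proof -
    have e: "2 * (- 1 - k) + 1 = - (2 * k + 1)" by simp
    have "(- of_int (2 * k + 1)) ^ j = (of_int (2 * k + 1) :: complex) ^ j" using assms by (rule power_minus_even)
    then show ?thesis unfolding e lcoef_minus of_int_minus by (simp only: mult_minus_right)
  qed
  ultimately have "((\<lambda>k. - ?f k) has_sum Phi x j 0) UNIV" by simp
  from has_sum_unique[OF this has_sum_uminusI[OF Phi_has_sum_0]] show ?thesis by simp
qed

lemma Phi_has_field_derivative:
  assumes z: "norm x * exp \<bar>Im z\<bar> < 1"
  shows "(Phi x j has_field_derivative \<i> * Phi x (Suc j) z) (at z)"
proof -
  obtain r where r: "norm x * exp \<bar>Im z\<bar> < r" "r < 1" using z dense by blast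
  have nx: "norm x > 0" using x by simp
  have rx: "norm x < r" using r(1) nx by (smt (verit) mult_le_cancel_left2 one_le_exp_iff abs_ge_zero mult_less_cancel_left2)
  \<comment> \<open>This half-width makes \<open>norm x * exp \<bar>Im y\<bar> \<le> r < 1\<close>
    for \<open>y\<close> in the strip \<open>S\<close>, so a single summable majorant serves all of
    \<open>S\<close>.\<close>
  define d where "d = ln (r / norm x)"
  have ed: "exp d = r / norm x" unfolding d_def using rx nx by (intro exp_ln divide_pos_pos) linarith+
  define S where "S = {z::complex. - d < Im z \<and> Im z < d}"
  have S: "norm x * exp \<bar>Im y\<bar> \<le> r" if "y \<in> S" for y
  proof -
    have "exp \<bar>Im y\<bar> \<le> exp d" using that by (simp add: S_def abs_le_iff)
    then have "norm x * exp \<bar>Im y\<bar> \<le> norm x * (r / norm x)" unfolding ed using nx by (intro mult_left_mono) auto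
    then show ?thesis using nx by simp
  qed
  have "exp \<bar>Im z\<bar> < exp d" unfolding ed using r(1) nx by (simp add: field_simps)
  then have zS: "z \<in> S" by (auto simp: S_def)
  have Seq: "S = {z. - d < Im z} \<inter> {z. Im z < d}" by (auto simp: S_def)
  have oS: "open S" unfolding Seq by (intro open_Int open_halfspace_Im_gt open_halfspace_Im_lt)
  have cS: "convex S" unfolding Seq by (intro convex_Int convex_halfspace_Im_gt convex_halfspace_Im_lt)
  let ?f = "\<lambda>j n z. of_int (2 * int_decode n + 1) ^ j * lcoef x (2 * int_decode n + 1) * exp (\<i> * of_int (2 * int_decode n + 1) * z)"
  have sums: "(\<lambda>n. ?f j n y) sums Phi x j y" if "y \<in> S" for j y
    using has_sum_int_decode[OF Phi_has_sum[of y j]] S[OF that] r(2) by simp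
  have "((\<lambda>y. \<Sum>n. ?f j n y) has_field_derivative (\<Sum>n. \<i> * ?f (Suc j) n z)) (at z)"
  proof (rule has_field_derivative_series'(2)[OF cS _ _ zS])
    show "(?f j n has_field_derivative \<i> * ?f (Suc j) n y) (at y within S)" for n y
      by (auto intro!: derivative_eq_intros)
    show "uniformly_convergent_on S (\<lambda>n y. \<Sum>i<n. \<i> * ?f (Suc j) i y)"
    proof (rule Weierstrass_m_test')
      let ?g = "\<lambda>n::int. 1 / (1 - norm x) * (\<bar>real_of_int n\<bar> ^ Suc j * r ^ nat \<bar>n\<bar>)"
      show "norm (\<i> * ?f (Suc j) n y) \<le> ?g (2 * int_decode n + 1)" if "y \<in> S" for n y
        using fourier_term_bound[OF S[OF that], of "2 * int_decode n + 1" "Suc j"] by (simp only: norm_mult norm_ii mult_1)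
      have "(\<lambda>n. ?g (n)) summable_on UNIV"
        using summable_on_int_power_geometric[of r "Suc j"] rx nx r(2) by (intro summable_on_cmult_right) auto
      then have "?g summable_on (range (\<lambda>k. 2 * k + 1))" using summable_on_subset_banach by blast
      then have "(\<lambda>k. ?g (2 * k + 1)) summable_on UNIV"
        by (subst (asm) summable_on_reindex) (auto simp: inj_def o_def)
      then have "(\<lambda>n. ?g (2 * int_decode n + 1)) summable_on UNIV"
        by (subst summable_on_reindex_bij_betw[OF bij_int_decode, of "\<lambda>k. ?g (2 * k + 1)"])
      then show "summable (\<lambda>n. ?g (2 * int_decode n + 1))" by (rule summable_on_imp_summable)
    qed
    show "summable (\<lambda>n. ?f j n z)" using sums[OF zS] by (rule sums_summable)
    show "z \<in> interior S" using zS oS by (simp add: interior_open)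
  qed
  moreover have "(\<Sum>n. \<i> * ?f (Suc j) n z) = \<i> * Phi x (Suc j) z"
    by (rule sums_unique[symmetric], rule sums_mult, rule sums[OF zS])
  ultimately have "((\<lambda>y. \<Sum>n. ?f j n y) has_field_derivative \<i> * Phi x (Suc j) z) (at z)" by simp
  then show ?thesis
    by (rule has_field_derivative_transform_within_open[OF _ oS zS]) (rule sums_unique[OF sums, symmetric])
qed

section \<open>Telescoping sums of hyperbolic cotangents\<close>

definition lrem :: "int \<Rightarrow> complex" where
  "lrem k = lcoth (2 * k + 1) - (if k \<ge> 0 then 1 else - 1)"

text \<open>For \<open>n \<noteq> 0\<close>,
  \<open>lcoth n = 1 + 2 * (x powi n * lcoef x n)\<close>; with oddness, \<open>lcoth\<close>
  approaches 1 and -1 at the two ends. It is not summable, but its deviation \<open>lrem\<close>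
  from the sign is, even with polynomial weights.\<close>

lemma lrem_bound: "norm (lrem k) \<le> 2 / (1 - norm x) * norm x ^ nat \<bar>k\<bar>"
proof -
  let ?n = "2 * k + 1"
  have cp: "lcoth n = 1 + 2 * (x powi n * lcoef x n)" if "n \<noteq> 0" for n
    using lcoef_denom_nonzero[OF that] by (simp add: lcoth_def lcoef_def field_simps)
  have "norm (lrem k) = 2 * (norm x ^ nat \<bar>?n\<bar> * norm (lcoef x ?n))"
  proof (cases "k \<ge> 0")
    case True
    then have "lrem k = 2 * (x ^ nat \<bar>?n\<bar> * lcoef x ?n)" using cp[of ?n] by (simp add: lrem_def power_int_def)
    then show ?thesis by (simp add: norm_mult norm_power)
  next
    case False
    then have "- ?n \<noteq> 0" "- ?n \<ge> 0" by presburger+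
    then have "lcoth (- ?n) = 1 + 2 * (x ^ nat \<bar>?n\<bar> * lcoef x (- ?n))" using cp[of "- ?n"] False by (simp add: power_int_nonneg_exp)
    then have "lrem k = 2 * (x ^ nat \<bar>?n\<bar> * lcoef x ?n)" using False unfolding lcoth_minus lcoef_minus
      by (simp add: lrem_def eq_neg_iff_add_eq_0 algebra_simps)
    then show ?thesis by (simp add: norm_mult norm_power)
  qed
  also have "\<dots> \<le> 2 * (1 * (1 / (1 - norm x) * norm x ^ nat \<bar>?n\<bar>))"
    using x by (intro mult_left_mono mult_mono lcoef_bound power_le_one) auto
  also have "\<dots> \<le> 2 * (1 * (1 / (1 - norm x) * norm x ^ nat \<bar>k\<bar>))"
    using x by (intro mult_left_mono power_decreasing) auto
  finally show ?thesis by simp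
qed

lemma lrem_summable: "(\<lambda>k. of_int k ^ j * lrem k) summable_on UNIV"
proof (rule summable_on_int_comparison[of "norm x" _ "2 / (1 - norm x)" j])
  show "norm (of_int k ^ j * lrem k) \<le> 2 / (1 - norm x) * (\<bar>of_int k\<bar> ^ j * norm x ^ nat \<bar>k\<bar>)" for k
    using mult_left_mono[OF lrem_bound[of k], of "\<bar>of_int k\<bar> ^ j"] unfolding norm_mult norm_power norm_of_int
    by (simp only: mult.left_commute) simp
qed (use x in auto)

abbreviation ldiff :: "int \<Rightarrow> complex" where
  "ldiff k \<equiv> lcoth (2 * k + 1) - lcoth (2 * k - 1)"

lemma ldiff_eq: "ldiff k = (if k = 0 then 2 else 0) + (lrem k - lrem (k - 1))"
proof -
  have "2 * (k - 1) + 1 = 2 * k - 1" by simp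
  then show ?thesis by (auto simp: lrem_def)
qed

text \<open>Telescoping: the total increase of \<open>lcoth\<close> from -1 to 1. In the unordered
  sum, the jump of the sign at \<open>k = 0\<close> gives the 2 and the two copies of
  \<open>lrem\<close> cancel after a shift.\<close>

lemma ldiff_has_sum: "(ldiff has_sum 2) UNIV"
proof -
  obtain E where E: "(lrem has_sum E) UNIV" using lrem_summable[of 0] unfolding summable_on_def by auto
  have E1: "((\<lambda>k. lrem (k - 1)) has_sum E) UNIV" using E has_sum_int_shift[of lrem "- 1"] by simp
  have "((\<lambda>k::int. if k = 0 then 2 else 0 :: complex) has_sum 2) UNIV"
    by (rule has_sum_finite_neutralI[of "{0}"]) auto
  from has_sum_add[OF this has_sum_diff[OF E E1]] show ?thesis by (simp add: ldiff_eq)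
qed

text \<open>\<open>ldiff\<close> is even because \<open>lcoth\<close> is odd, so the summand is odd.
  The work lies in the summability.\<close>

lemma ldiff_moment_has_sum: "((\<lambda>k. of_int k * ldiff k) has_sum 0) UNIV"
proof -
  have "(\<lambda>k. of_int k * ldiff k) summable_on UNIV"
  proof -
    have a: "(\<lambda>k. of_int k * lrem k) summable_on UNIV" using lrem_summable[of 1] by simp
    have "(\<lambda>k. of_int k * lrem k + lrem k) summable_on UNIV"
      using lrem_summable[of 0] by (intro summable_on_add a) simp
    from summable_on_int_affine[OF this, of 1 "- 1"]
    have b: "(\<lambda>k. of_int k * lrem (k - 1)) summable_on UNIV" by (simp add: algebra_simps)
    have "(\<lambda>k. of_int k * lrem k - of_int k * lrem (k - 1)) summable_on UNIV"
      using a b has_sum_diff unfolding summable_on_def by blast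
    then show ?thesis unfolding ldiff_eq
      by (rule summable_on_cong[THEN iffD1, rotated]) (auto simp: algebra_simps)
  qed
  then obtain E where E: "((\<lambda>k. of_int k * ldiff k) has_sum E) UNIV" unfolding summable_on_def by auto
  have "((\<lambda>k. of_int (0 - k) * ldiff (0 - k)) has_sum E) UNIV"
    using E has_sum_int_reflect[of "\<lambda>k. of_int k * ldiff k" 0] by blast
  moreover have "of_int (0 - k) * ldiff (0 - k) = - (of_int k * ldiff k)" for k
  proof -
    have e: "2 * (0 - k) + 1 = - (2 * k - 1)" "2 * (0 - k) - 1 = - (2 * k + 1)" by simp_all
    show ?thesis unfolding e lcoth_minus by simp
  qed
  ultimately have "((\<lambda>k. - (of_int k * ldiff k)) has_sum E) UNIV" by (simp only:)
  from has_sum_unique[OF this has_sum_uminusI[OF E]] have "E = 0" by simp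
  then show ?thesis using E by simp
qed

lemma lcoth_shift_has_sum: "((\<lambda>k. lcoth (2 * k + 1) - lcoth (2 * (k - M) + 1)) has_sum of_int (2 * M)) UNIV"
proof (induction M rule: int_induct[of _ 0])
  case base
  then show ?case by simp
next
  case (step1 i)
  have "((\<lambda>k. ldiff (k - i)) has_sum 2) UNIV" using ldiff_has_sum has_sum_int_shift[of ldiff "- i"] by simp
  from has_sum_add[OF step1(2) this] show ?case by (simp add: algebra_simps)
next
  case (step2 i)
  have "((\<lambda>k. ldiff (k - (i - 1))) has_sum 2) UNIV" using ldiff_has_sum has_sum_int_shift[of ldiff "- (i - 1)"] by simp
  from has_sum_diff[OF step2(2) this] show ?case by (simp add: algebra_simps)
qed

section \<open>The square of the elliptic function\<close>

definition Phi_sqr :: "complex \<Rightarrow> complex" where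
  "Phi_sqr z = (\<Sum>\<^sub>\<infinity>k::int. of_int (2 * k) * lcoef x (2 * k) * exp (\<i> * of_int (2 * k) * z))"

lemma Phi_sqr_has_sum:
  assumes "norm x * exp \<bar>Im z\<bar> < 1"
  shows "((\<lambda>k::int. of_int (2 * k) * lcoef x (2 * k) * exp (\<i> * of_int (2 * k) * z)) has_sum Phi_sqr z) UNIV"
  unfolding Phi_sqr_def
  by (rule has_sum_infsum) (use summable_on_int_affine[OF fourier_summable[OF assms, of 1], where m = 2 and c = 0] in simp)

text \<open>The constant Fourier coefficient of the square, where the addition law fails because
  \<open>i + j = 0\<close>. Its value is never computed: it is absorbed in \<open>ode_coeff\<close>
  or eliminated through \<open>Phi x 0 0 = 0\<close>.\<close>

definition Phi_const :: complex where
  "Phi_const = (\<Sum>\<^sub>\<infinity>k::int. lcoef x (2 * k + 1) * lcoef x (- (2 * k + 1)))"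

text \<open>The two frequencies add up to \<open>2 * (N + 1)\<close>. For \<open>N = - 1\<close>
  this is 0 and the sum is \<open>Phi_const\<close> by definition; otherwise
  \<open>lcoef_mult\<close> makes it a multiple of the telescoping sum
  \<open>lcoth_shift_has_sum\<close> with shift \<open>N + 1\<close>.\<close>

lemma Phi_0_convolution:
  "((\<lambda>k. lcoef x (2 * k + 1) * lcoef x (2 * (N - k) + 1)) has_sum
     (if N = - 1 then Phi_const else 0) + 1 / 2 * (of_int (2 * (N + 1)) * lcoef x (2 * (N + 1)))) UNIV"
proof (cases "N = - 1")
  case True
  have a: "((\<lambda>k. lcoef x (2 * k + 1)) has_sum Phi x 0 0) UNIV" using Phi_has_sum_0[of 0] by simp
  from has_sum_int_convolution(1)[OF a a, of N]
  have "((\<lambda>k. lcoef x (2 * k + 1) * lcoef x (2 * (N - k) + 1)) has_sum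
      (\<Sum>\<^sub>\<infinity>k. lcoef x (2 * k + 1) * lcoef x (2 * (N - k) + 1))) UNIV" by (rule has_sum_infsum)
  moreover have "2 * (N - k) + 1 = - (2 * k + 1)" for k using True by simp
  ultimately show ?thesis using True by (simp only: Phi_const_def[symmetric]) simp
next
  case False
  have "((\<lambda>k. 1 / 2 * lcoef x (2 * (N + 1)) * (lcoth (2 * k + 1) - lcoth (2 * (k - (N + 1)) + 1))) has_sum
     1 / 2 * lcoef x (2 * (N + 1)) * of_int (2 * (N + 1))) UNIV"
    by (intro has_sum_cmult_right lcoth_shift_has_sum)
  moreover have "1 / 2 * lcoef x (2 * (N + 1)) * (lcoth (2 * k + 1) - lcoth (2 * (k - (N + 1)) + 1))
      = lcoef x (2 * k + 1) * lcoef x (2 * (N - k) + 1)" for k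
  proof -
    have "2 * k + 1 \<noteq> 0" "2 * (N - k) + 1 \<noteq> 0" by presburger+
    moreover have s: "2 * k + 1 + (2 * (N - k) + 1) = 2 * (N + 1)" by simp
    moreover have "2 * (N + 1) \<noteq> 0" using False by simp
    ultimately have "lcoef x (2 * k + 1) * lcoef x (2 * (N - k) + 1) = 1 / 2 * lcoef x (2 * (N + 1)) * (lcoth (2 * k + 1) + lcoth (2 * (N - k) + 1))"
      using lcoef_mult[of "2 * k + 1" "2 * (N - k) + 1"] by (simp only: s simp_thms)
    moreover have "2 * (N - k) + 1 = - (2 * (k - (N + 1)) + 1)" by simp
    ultimately show ?thesis by (simp only: lcoth_minus diff_conv_add_uminus)
  qed
  ultimately show ?thesis using False by (simp add: mult.commute mult.left_commute)
qed

lemma Phi_0_square: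
  assumes z: "norm x * exp \<bar>Im z\<bar> < 1"
  shows "Phi x 0 z ^ 2 = Phi_const + 1 / 2 * Phi_sqr z"
proof -
  let ?e = "\<lambda>n::int. exp (\<i> * of_int n * z)"
  have ee: "?e m * ?e n = ?e (m + n)" for m n by (simp add: exp_add[symmetric] algebra_simps)
  have a: "((\<lambda>k. lcoef x (2 * k + 1) * ?e (2 * k + 1)) has_sum Phi x 0 z) UNIV"
    using Phi_has_sum[OF z, of 0] by simp
  let ?c = "\<lambda>N. (if N = - 1 then Phi_const else 0) + 1 / 2 * (of_int (2 * (N + 1)) * lcoef x (2 * (N + 1)))"
  have "(\<Sum>\<^sub>\<infinity>k. lcoef x (2 * k + 1) * ?e (2 * k + 1) * (lcoef x (2 * (N - k) + 1) * ?e (2 * (N - k) + 1))) = ?c N * ?e (2 * (N + 1))" for N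
  proof (rule infsumI)
    have "lcoef x (2 * k + 1) * ?e (2 * k + 1) * (lcoef x (2 * (N - k) + 1) * ?e (2 * (N - k) + 1))
       = lcoef x (2 * k + 1) * lcoef x (2 * (N - k) + 1) * ?e (2 * (N + 1))" for k
    proof -
      have "?e (2 * k + 1) * ?e (2 * (N - k) + 1) = ?e (2 * (N + 1))"
        unfolding ee by (rule arg_cong[of _ _ ?e]) simp
      then show ?thesis by (rule mult_interchange)
    qed
    then show "((\<lambda>k. lcoef x (2 * k + 1) * ?e (2 * k + 1) * (lcoef x (2 * (N - k) + 1) * ?e (2 * (N - k) + 1))) has_sum ?c N * ?e (2 * (N + 1))) UNIV"
      using has_sum_cmult_left[OF Phi_0_convolution[of N], of "?e (2 * (N + 1))"] by (simp only:)
  qed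
  with has_sum_int_convolution(2)[OF a a]
  have 1: "((\<lambda>N. ?c N * ?e (2 * (N + 1))) has_sum (Phi x 0 z * Phi x 0 z)) UNIV" by (simp only:)
  have "((\<lambda>N. of_int (2 * (N + 1)) * lcoef x (2 * (N + 1)) * ?e (2 * (N + 1))) has_sum Phi_sqr z) UNIV"
    using Phi_sqr_has_sum[OF z] has_sum_int_shift[of "\<lambda>k. of_int (2 * k) * lcoef x (2 * k) * ?e (2 * k)" 1] by blast
  then have "((\<lambda>N. 1 / 2 * (of_int (2 * (N + 1)) * lcoef x (2 * (N + 1)) * ?e (2 * (N + 1)))) has_sum 1 / 2 * Phi_sqr z) UNIV"
    by (rule has_sum_cmult_right)
  moreover have "((\<lambda>N. if N = - 1 then Phi_const else 0) has_sum Phi_const) (UNIV :: int set)"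
    by (rule has_sum_finite_neutralI[of "{- 1}"]) auto
  ultimately have "((\<lambda>N. (if N = - 1 then Phi_const else 0) + 1 / 2 * (of_int (2 * (N + 1)) * lcoef x (2 * (N + 1)) * ?e (2 * (N + 1)))) has_sum (Phi_const + 1 / 2 * Phi_sqr z)) UNIV"
    by (intro has_sum_add)
  moreover have "(if N = - 1 then Phi_const else 0) + 1 / 2 * (of_int (2 * (N + 1)) * lcoef x (2 * (N + 1)) * ?e (2 * (N + 1))) = ?c N * ?e (2 * (N + 1))" for N
    by (cases "N = - 1") simp_all
  ultimately have "((\<lambda>N. ?c N * ?e (2 * (N + 1))) has_sum (Phi_const + 1 / 2 * Phi_sqr z)) UNIV" by (simp only:)
  from has_sum_unique[OF 1 this] show ?thesis by (simp add: power2_eq_square)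
qed

section \<open>The cube and the differential equation\<close>

definition cubic_coeff :: "int \<Rightarrow> complex" where
  "cubic_coeff N = (\<Sum>\<^sub>\<infinity>k. of_int (2 * k) * (lcoth (2 * k) + lcoth (2 * (N - k) + 1)))"

text \<open>This is where \<open>cubic_coeff\<close> comes from: the coefficient of frequency
  \<open>2 * N + 1\<close> in \<open>Phi_sqr z * Phi x 0 z\<close> is
  \<open>1 / 2 * lcoef x (2 * N + 1) * cubic_coeff N\<close>. For \<open>k = 0\<close>, where
  \<open>lcoef_mult\<close> does not apply, the weight \<open>2 * k\<close> kills both
  sides.\<close>

lemma lcoef_even_odd_mult:
  "of_int (2 * k) * lcoef x (2 * k) * lcoef x (2 * (N - k) + 1) =
    1 / 2 * lcoef x (2 * N + 1) * (of_int (2 * k) * (lcoth (2 * k) + lcoth (2 * (N - k) + 1)))"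
proof (cases "k = 0")
  case False
  have "2 * (N - k) + 1 \<noteq> 0" by presburger
  moreover have s: "2 * k + (2 * (N - k) + 1) = 2 * N + 1" by simp
  moreover have "2 * N + 1 \<noteq> 0" by presburger
  ultimately have "lcoef x (2 * k) * lcoef x (2 * (N - k) + 1) = 1 / 2 * lcoef x (2 * N + 1) * (lcoth (2 * k) + lcoth (2 * (N - k) + 1))"
    using lcoef_mult[of "2 * k" "2 * (N - k) + 1"] False by (simp only: s) simp
  then show ?thesis by (simp only: mult.assoc mult.left_commute)
qed simp

text \<open>Summability is obtained backwards: the convolution is known to be summable, and its
  terms are a nonzero constant times these.\<close>

lemma cubic_coeff_has_sum:
  "((\<lambda>k. of_int (2 * k) * (lcoth (2 * k) + lcoth (2 * (N - k) + 1))) has_sum cubic_coeff N) UNIV"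
proof -
  have a: "((\<lambda>k. lcoef x (2 * k + 1)) has_sum Phi x 0 0) UNIV" using Phi_has_sum_0[of 0] by simp
  have b: "((\<lambda>k. of_int (2 * k) * lcoef x (2 * k)) has_sum Phi_sqr 0) UNIV" using Phi_sqr_has_sum[of 0] x by simp
  have "(\<lambda>k. 1 / 2 * lcoef x (2 * N + 1) * (of_int (2 * k) * (lcoth (2 * k) + lcoth (2 * (N - k) + 1)))) summable_on UNIV"
    using has_sum_int_convolution(1)[OF b a, of N] by (simp only: lcoef_even_odd_mult)
  then have "(\<lambda>k. 2 / lcoef x (2 * N + 1) * (1 / 2 * lcoef x (2 * N + 1) * (of_int (2 * k) * (lcoth (2 * k) + lcoth (2 * (N - k) + 1))))) summable_on UNIV"
    by (rule summable_on_cmult_right)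
  moreover have "2 * N + 1 \<noteq> 0" by presburger
  then have "2 / lcoef x (2 * N + 1) * (1 / 2 * lcoef x (2 * N + 1) * c) = c" for c
    using lcoef_nonzero[of "2 * N + 1"] by simp
  ultimately have "(\<lambda>k. of_int (2 * k) * (lcoth (2 * k) + lcoth (2 * (N - k) + 1))) summable_on UNIV"
    by (simp only:)
  then show ?thesis unfolding cubic_coeff_def by (rule has_sum_infsum)
qed

text \<open>In the difference only \<open>of_int (2 * k) * ldiff (N + 1 - k)\<close> survives. With
  \<open>m = N + 1 - k\<close> the weight is \<open>2 * (N + 1) - 2 * m\<close>, so
  \<open>ldiff_has_sum\<close> and \<open>ldiff_moment_has_sum\<close> give
  \<open>2 * (N + 1) * 2 - 0\<close>.\<close>

lemma cubic_coeff_step: "cubic_coeff (N + 1) = cubic_coeff N + of_int (4 * (N + 1))"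
proof -
  have "((\<lambda>m. of_int (2 * (N + 1)) * ldiff m - 2 * (of_int m * ldiff m)) has_sum (of_int (2 * (N + 1)) * 2 - 2 * 0)) UNIV"
    by (intro has_sum_diff has_sum_cmult_right ldiff_has_sum ldiff_moment_has_sum)
  then have "((\<lambda>k. of_int (2 * (N + 1)) * ldiff (N + 1 - k) - 2 * (of_int (N + 1 - k) * ldiff (N + 1 - k))) has_sum of_int (4 * (N + 1))) UNIV"
    using has_sum_int_reflect[of "\<lambda>m. of_int (2 * (N + 1)) * ldiff m - 2 * (of_int m * ldiff m)" "N + 1"] by simp
  moreover have "of_int (2 * (N + 1)) * ldiff (N + 1 - k) - 2 * (of_int (N + 1 - k) * ldiff (N + 1 - k)) =
    of_int (2 * k) * (lcoth (2 * k) + lcoth (2 * (N + 1 - k) + 1)) - of_int (2 * k) * (lcoth (2 * k) + lcoth (2 * (N - k) + 1))" for k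
  proof -
    have "2 * (N + 1 - k) - 1 = 2 * (N - k) + 1" by simp
    then show ?thesis by (simp only:) (simp add: algebra_simps)
  qed
  ultimately have 1: "((\<lambda>k. of_int (2 * k) * (lcoth (2 * k) + lcoth (2 * (N + 1 - k) + 1)) - of_int (2 * k) * (lcoth (2 * k) + lcoth (2 * (N - k) + 1)))
      has_sum of_int (4 * (N + 1))) UNIV" by (simp only:)
  from has_sum_unique[OF has_sum_diff[OF cubic_coeff_has_sum[of "N + 1"] cubic_coeff_has_sum[of N]] 1]
  show ?thesis by (simp add: algebra_simps)
qed

text \<open>Since \<open>2 * N * (N + 1) = ((2 * N + 1) ^ 2 - 1) / 2\<close>, the dependence on the
  frequency \<open>n\<close> is a multiple of \<open>n ^ 2\<close> plus a constant, which is what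
  produces the second derivative.\<close>

lemma cubic_coeff_eq: "cubic_coeff N = cubic_coeff 0 + of_int (2 * N * (N + 1))"
proof (induction N rule: int_induct[of _ 0])
  case base
  then show ?case by simp
next
  case (step1 i)
  then show ?case using cubic_coeff_step[of i] by (simp add: algebra_simps)
next
  case (step2 i)
  then show ?case using cubic_coeff_step[of "i - 1"] by (simp add: algebra_simps)
qed

text \<open>Collects the constants left after solving for \<open>Phi x 2\<close> in
  \<open>Phi_ode\<close>; the -1 stems from \<open>((2 * N + 1) ^ 2 - 1) / 2\<close> in
  \<open>cubic_coeff_eq\<close>.\<close>

definition ode_coeff :: complex where
  "ode_coeff = 8 * Phi_const + 2 * cubic_coeff 0 - 1"

lemma Phi_ode:
  assumes z: "norm x * exp \<bar>Im z\<bar> < 1"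
  shows "Phi x 2 z = 8 * Phi x 0 z ^ 3 - ode_coeff * Phi x 0 z"
proof -
  let ?e = "\<lambda>n::int. exp (\<i> * of_int n * z)"
  have ee: "?e m * ?e n = ?e (m + n)" for m n by (simp add: exp_add[symmetric] algebra_simps)
  have a: "((\<lambda>k. lcoef x (2 * k + 1) * ?e (2 * k + 1)) has_sum Phi x 0 z) UNIV"
    using Phi_has_sum[OF z, of 0] by simp
  have "(\<Sum>\<^sub>\<infinity>k. of_int (2 * k) * lcoef x (2 * k) * ?e (2 * k) * (lcoef x (2 * (N - k) + 1) * ?e (2 * (N - k) + 1)))
      = 1 / 2 * lcoef x (2 * N + 1) * cubic_coeff N * ?e (2 * N + 1)" for N
  proof (rule infsumI)
    have "of_int (2 * k) * lcoef x (2 * k) * ?e (2 * k) * (lcoef x (2 * (N - k) + 1) * ?e (2 * (N - k) + 1))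
       = 1 / 2 * lcoef x (2 * N + 1) * (of_int (2 * k) * (lcoth (2 * k) + lcoth (2 * (N - k) + 1))) * ?e (2 * N + 1)" for k
    proof -
      have "?e (2 * k) * ?e (2 * (N - k) + 1) = ?e (2 * N + 1)"
        unfolding ee by (rule arg_cong[of _ _ ?e]) simp
      then show ?thesis unfolding lcoef_even_odd_mult[symmetric] by (rule mult_interchange)
    qed
    then show "((\<lambda>k. of_int (2 * k) * lcoef x (2 * k) * ?e (2 * k) * (lcoef x (2 * (N - k) + 1) * ?e (2 * (N - k) + 1))) has_sum
        1 / 2 * lcoef x (2 * N + 1) * cubic_coeff N * ?e (2 * N + 1)) UNIV"
      using has_sum_cmult_left[OF has_sum_cmult_right[OF cubic_coeff_has_sum[of N], of "1 / 2 * lcoef x (2 * N + 1)"], of "?e (2 * N + 1)"]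
      by (simp only:)
  qed
  with has_sum_int_convolution(2)[OF Phi_sqr_has_sum[OF z] a]
  have 1: "((\<lambda>N. 1 / 2 * lcoef x (2 * N + 1) * cubic_coeff N * ?e (2 * N + 1)) has_sum (Phi_sqr z * Phi x 0 z)) UNIV" by (simp only:)
  have "((\<lambda>N. 1 / 4 * (of_int (2 * N + 1) ^ 2 * lcoef x (2 * N + 1) * ?e (2 * N + 1)) +
      (1 / 2 * cubic_coeff 0 - 1 / 4) * (lcoef x (2 * N + 1) * ?e (2 * N + 1))) has_sum
      (1 / 4 * Phi x 2 z + (1 / 2 * cubic_coeff 0 - 1 / 4) * Phi x 0 z)) UNIV"
    by (intro has_sum_add has_sum_cmult_right Phi_has_sum z a)
  moreover have "1 / 4 * (of_int (2 * N + 1) ^ 2 * lcoef x (2 * N + 1) * ?e (2 * N + 1)) +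
      (1 / 2 * cubic_coeff 0 - 1 / 4) * (lcoef x (2 * N + 1) * ?e (2 * N + 1)) =
      1 / 2 * lcoef x (2 * N + 1) * cubic_coeff N * ?e (2 * N + 1)" for N
  proof -
    have "1 / 4 * (of_int (2 * N + 1) ^ 2 * l * e) + (1 / 2 * cubic_coeff 0 - 1 / 4) * (l * e) =
       1 / 2 * l * cubic_coeff N * e" for l e :: complex
      unfolding cubic_coeff_eq[of N] by (simp add: field_simps power2_eq_square)
    then show ?thesis .
  qed
  ultimately have "((\<lambda>N. 1 / 2 * lcoef x (2 * N + 1) * cubic_coeff N * ?e (2 * N + 1)) has_sum
      (1 / 4 * Phi x 2 z + (1 / 2 * cubic_coeff 0 - 1 / 4) * Phi x 0 z)) UNIV" by (simp only:)
  from has_sum_unique[OF 1 this]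
  have "Phi_sqr z * Phi x 0 z = 1 / 4 * Phi x 2 z + (1 / 2 * cubic_coeff 0 - 1 / 4) * Phi x 0 z" .
  moreover have "Phi x 0 z ^ 3 = Phi_const * Phi x 0 z + 1 / 2 * (Phi_sqr z * Phi x 0 z)"
    using Phi_0_square[OF z] by (simp add: power3_eq_cube power2_eq_square algebra_simps)
  ultimately have "Phi x 0 z ^ 3 = Phi_const * Phi x 0 z +
      1 / 2 * (1 / 4 * Phi x 2 z + (1 / 2 * cubic_coeff 0 - 1 / 4) * Phi x 0 z)" by (simp only:)
  then show ?thesis by (simp add: ode_coeff_def field_simps)
qed

section \<open>Moments at the origin from the differential equation\<close>

lemma open_strip: "open {z. norm x * exp \<bar>Im z\<bar> < 1}"
  by (intro open_Collect_less continuous_intros)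

lemma Phi_Suc_eqI:
  assumes eq: "\<And>z. norm x * exp \<bar>Im z\<bar> < 1 \<Longrightarrow> Phi x j z = g z"
    and z: "norm x * exp \<bar>Im z\<bar> < 1" and g: "(g has_field_derivative \<i> * D) (at z)"
  shows "Phi x (Suc j) z = D"
proof -
  have "(Phi x j has_field_derivative \<i> * D) (at z)"
    by (rule has_field_derivative_transform_within_open[OF g open_strip]) (use z eq in auto)
  from DERIV_unique[OF Phi_has_field_derivative[OF z] this] show ?thesis by simp
qed

lemma Phi_derivs:
  assumes z: "norm x * exp \<bar>Im z\<bar> < 1"
  shows "(Phi x 0 has_field_derivative \<i> * Phi x 1 z) (at z)"
    and "(Phi x 1 has_field_derivative \<i> * Phi x 2 z) (at z)"
    and "(Phi x 2 has_field_derivative \<i> * Phi x 3 z) (at z)"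
proof -
  have e: "Suc 0 = 1" "Suc 1 = 2" "Suc 2 = (3::nat)" by simp_all
  show "(Phi x 0 has_field_derivative \<i> * Phi x 1 z) (at z)"
    using Phi_has_field_derivative[OF z, of 0] by (simp only: e)
  show "(Phi x 1 has_field_derivative \<i> * Phi x 2 z) (at z)"
    using Phi_has_field_derivative[OF z, of 1] by (simp only: e)
  show "(Phi x 2 has_field_derivative \<i> * Phi x 3 z) (at z)"
    using Phi_has_field_derivative[OF z, of 2] by (simp only: e)
qed

lemma Phi_3_eq:
  assumes z: "norm x * exp \<bar>Im z\<bar> < 1"
  shows "Phi x 3 z = 24 * Phi x 0 z ^ 2 * Phi x 1 z - ode_coeff * Phi x 1 z"
proof -
  have "Phi x (Suc 2) z = 24 * Phi x 0 z ^ 2 * Phi x 1 z - ode_coeff * Phi x 1 z"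
    by (rule Phi_Suc_eqI[OF Phi_ode z])
       (auto intro!: derivative_eq_intros Phi_derivs z simp: algebra_simps simp del: One_nat_def)
  then show ?thesis by (simp add: numeral_3_eq_3)
qed

lemma Phi_4_eq:
  assumes z: "norm x * exp \<bar>Im z\<bar> < 1"
  shows "Phi x 4 z = 48 * Phi x 0 z * Phi x 1 z ^ 2 + 24 * Phi x 0 z ^ 2 * Phi x 2 z - ode_coeff * Phi x 2 z"
proof -
  have "Phi x (Suc 3) z = 48 * Phi x 0 z * Phi x 1 z ^ 2 + 24 * Phi x 0 z ^ 2 * Phi x 2 z - ode_coeff * Phi x 2 z"
    by (rule Phi_Suc_eqI[OF Phi_3_eq z])
       (auto intro!: derivative_eq_intros Phi_derivs z simp: algebra_simps power2_eq_square simp del: One_nat_def)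
  then show ?thesis by simp
qed

lemma Phi_5_eq:
  assumes z: "norm x * exp \<bar>Im z\<bar> < 1"
  shows "Phi x 5 z = 48 * Phi x 1 z ^ 3 + 144 * Phi x 0 z * Phi x 1 z * Phi x 2 z
    + 24 * Phi x 0 z ^ 2 * Phi x 3 z - ode_coeff * Phi x 3 z"
proof -
  have "Phi x (Suc 4) z = 48 * Phi x 1 z ^ 3 + 144 * Phi x 0 z * Phi x 1 z * Phi x 2 z
    + 24 * Phi x 0 z ^ 2 * Phi x 3 z - ode_coeff * Phi x 3 z"
    by (rule Phi_Suc_eqI[OF Phi_4_eq z])
       (auto intro!: derivative_eq_intros Phi_derivs z simp: algebra_simps power2_eq_square power3_eq_cube simp del: One_nat_def)
  then show ?thesis by simp
qed

lemma Phi_3_0: "Phi x 3 0 = - ode_coeff * Phi x 1 0"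
  using Phi_3_eq[of 0] x Phi_even_0[of 0] by simp

text \<open>As \<open>Phi x 0 0 = 0\<close>, only the cube and the last term of
  \<open>Phi_5_eq\<close> remain, and \<open>Phi_3_0\<close> rewrites the latter.\<close>

lemma Phi_5_0: "Phi x 5 0 = 48 * Phi x 1 0 ^ 3 + ode_coeff ^ 2 * Phi x 1 0"
  using Phi_5_eq[of 0] x Phi_even_0[of 0] Phi_3_0 by (simp add: power2_eq_square)

section \<open>Values at pi / 2 and the first integral\<close>

lemma exp_half_pi: "exp (\<i> * of_int n * of_real (pi / 2)) = \<i> powi n"
proof -
  have "exp (\<i> * of_int n * of_real (pi / 2)) = exp (\<i> * of_real (pi / 2)) powi n"
    by (simp add: exp_power_int mult.commute mult.left_commute)
  then show ?thesis using cis_pi_half by (simp add: cis_conv_exp)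
qed

lemma i_powi_even: "\<i> powi (2 * k) = (- 1) powi k"
  by (simp add: power_int_mult)

lemma i_powi_odd: "\<i> powi (2 * k + 1) = \<i> * (- 1) powi k"
  by (simp add: power_int_add i_powi_even)

lemma Phi_half_pi_has_sum:
  "((\<lambda>k. of_int (2 * k + 1) ^ j * lcoef x (2 * k + 1) * (\<i> * (- 1) powi k)) has_sum Phi x j (of_real (pi / 2))) UNIV"
  using Phi_has_sum[of "of_real (pi / 2)" j] x unfolding exp_half_pi i_powi_odd by simp

text \<open>Here \<open>n * lcoef x n\<close> is even in \<open>n\<close>, while
  \<open>\<i> powi n\<close> is odd for odd \<open>n\<close>. This is what makes pi / 2 a useful end
  point for the first integral.\<close>

lemma Phi_1_half_pi: "Phi x 1 (of_real (pi / 2)) = 0"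
proof -
  let ?f = "\<lambda>k::int. of_int (2 * k + 1) ^ 1 * lcoef x (2 * k + 1) * (\<i> * (- 1) powi k)"
  have "((\<lambda>k. ?f (- 1 - k)) has_sum Phi x 1 (of_real (pi / 2))) UNIV"
    using Phi_half_pi_has_sum[of 1] has_sum_int_reflect[of ?f "- 1"] by blast
  moreover have "?f (- 1 - k) = - ?f k" for k
  proof -
    have e: "2 * (- 1 - k) + 1 = - (2 * k + 1)" by simp
    have "(- 1) powi (- 1 - k) = (- ((- 1) powi k) :: complex)"
      using power_int_minus_one_minus[of "1 + k"] by (simp add: power_int_add)
    then show ?thesis unfolding e lcoef_minus of_int_minus
      by (simp only: power_one_right mult_minus_left mult_minus_right minus_minus)
  qed
  ultimately have "((\<lambda>k. - ?f k) has_sum Phi x 1 (of_real (pi / 2))) UNIV" by (simp only:)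
  from has_sum_unique[OF this has_sum_uminusI[OF Phi_half_pi_has_sum]] show ?thesis by simp
qed

text \<open>Writing \<open>lcoef x n = x powi n / (1 - x powi (2 * n))\<close> with
  \<open>n = 2 * k + 1\<close> turns the series into \<open>lambert_psi\<close> for
  \<open>p = x ^ 2\<close>, up to the factor \<open>\<i> * x\<close>.\<close>

lemma Phi_0_half_pi: "Phi x 0 (of_real (pi / 2)) = 2 * \<i> * x * psi (x ^ 4) ^ 2"
proof -
  have p: "norm (x ^ 2) < 1" "x ^ 2 \<noteq> 0" using x by (simp_all add: norm_power power_less_one_iff)
  have "((\<lambda>k. \<i> * x * ((- (x ^ 2)) powi k / (1 - (x ^ 2) powi (2 * k + 1)))) has_sum \<i> * x * (2 * psi ((x ^ 2) ^ 2) ^ 2)) UNIV"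
    by (intro has_sum_cmult_right lambert_psi p)
  moreover have "\<i> * x * ((- (x ^ 2)) powi k / (1 - (x ^ 2) powi (2 * k + 1))) =
      of_int (2 * k + 1) ^ 0 * lcoef x (2 * k + 1) * (\<i> * (- 1) powi k)" for k
  proof -
    define X where "X = x powi (2 * k + 1)"
    have X0: "X \<noteq> 0" using x by (simp add: X_def)
    have a: "(x ^ 2) powi (2 * k + 1) = X * X"
    proof -
      have "(x ^ 2) powi (2 * k + 1) = x powi ((2 * k + 1) + (2 * k + 1))" unfolding power_int_power by (rule arg_cong[of _ _ "(powi) x"]) simp
      then show ?thesis unfolding X_def using x by (simp only: power_int_add simp_thms)
    qed
    have b: "x * (- (x ^ 2)) powi k = (- 1) powi k * X"
    proof -
      have "(- (x ^ 2)) powi k = (- 1) powi k * (x ^ 2) powi k" using power_int_mult_distrib[of "- 1" "x ^ 2" k] by simp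
      moreover have "X = x powi (2 * k) * x" using x by (simp add: X_def power_int_add)
      ultimately show ?thesis by (simp add: power_int_power)
    qed
    have "2 * k + 1 \<noteq> 0" by presburger
    from lcoef_denom_nonzero[OF this] have nz: "inverse X - X \<noteq> 0" unfolding power_int_minus X_def .
    have "1 / (inverse X - X) = X / (1 - X * X)" using X0 nz by (simp add: field_simps)
    then have c: "lcoef x (2 * k + 1) = X / (1 - X * X)" unfolding lcoef_def power_int_minus X_def .
    have "\<i> * x * ((- (x ^ 2)) powi k / (1 - (x ^ 2) powi (2 * k + 1))) = \<i> * (x * (- (x ^ 2)) powi k) / (1 - X * X)"
      unfolding a by simp
    then show ?thesis unfolding b c by simp
  qed
  ultimately have "((\<lambda>k. of_int (2 * k + 1) ^ 0 * lcoef x (2 * k + 1) * (\<i> * (- 1) powi k)) has_sum \<i> * x * (2 * psi ((x ^ 2) ^ 2) ^ 2)) UNIV"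
    by (simp only:)
  from has_sum_unique[OF Phi_half_pi_has_sum this] show ?thesis by simp
qed

text \<open>The energy integral of \<open>Phi_ode\<close>, obtained by multiplying it with the
  derivative. At 0 only \<open>Phi x 1\<close> survives, at pi / 2 only
  \<open>Phi x 0\<close>.\<close>

lemma Phi_first_integral:
  "Phi x 1 0 ^ 2 = ode_coeff * Phi x 0 (of_real (pi / 2)) ^ 2 - 4 * Phi x 0 (of_real (pi / 2)) ^ 4"
proof -
  define E where "E z = Phi x 1 z ^ 2 - 4 * Phi x 0 z ^ 4 + ode_coeff * Phi x 0 z ^ 2" for z
  let ?S = "closed_segment 0 (complex_of_real (pi / 2))"
  have "(E has_field_derivative 0) (at z within ?S)" if "z \<in> ?S" for z
  proof -
    have "Im z = 0" using that by (auto simp: closed_segment_def)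
    then have z: "norm x * exp \<bar>Im z\<bar> < 1" using x by simp
    have "(E has_field_derivative (2 * Phi x 1 z * (\<i> * Phi x 2 z) - 16 * Phi x 0 z ^ 3 * (\<i> * Phi x 1 z)
        + ode_coeff * (2 * Phi x 0 z * (\<i> * Phi x 1 z)))) (at z)"
      unfolding E_def by (auto intro!: derivative_eq_intros Phi_derivs z simp: algebra_simps simp del: One_nat_def)
    also have "2 * Phi x 1 z * (\<i> * Phi x 2 z) - 16 * Phi x 0 z ^ 3 * (\<i> * Phi x 1 z)
        + ode_coeff * (2 * Phi x 0 z * (\<i> * Phi x 1 z)) = 0"
      unfolding Phi_ode[OF z] by (simp add: algebra_simps)
    finally show ?thesis by (rule has_field_derivative_at_within)
  qed
  then obtain c where "\<And>z. z \<in> ?S \<Longrightarrow> E z = c"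
    using has_field_derivative_zero_constant[of ?S E] by auto
  then have "E 0 = E (of_real (pi / 2))" by simp
  then show ?thesis using Phi_even_0[of 0] Phi_1_half_pi by (simp add: E_def)
qed

text \<open>Between 0 and pi / 2 the square of Phi changes only through the frequencies
  \<open>2 * (2 * m + 1)\<close>, whose sign flips, and
  \<open>lcoef x (2 * n) = lcoef (x ^ 2) n\<close>; so the value at pi / 2 yields the first moment
  for \<open>x ^ 2\<close>. The premise is \<open>Phi_has_sum_0\<close> for \<open>x ^ 2\<close>,
  which is available only once \<open>x\<close> is no longer fixed.\<close>

lemma Phi_1_0_power2:
  assumes Phi2: "((\<lambda>k::int. of_int (2 * k + 1) ^ 1 * lcoef (x ^ 2) (2 * k + 1)) has_sum Phi (x ^ 2) 1 0) UNIV"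
  shows "Phi (x ^ 2) 1 0 = 2 * x ^ 2 * psi (x ^ 4) ^ 4"
proof -
  let ?b = "\<lambda>k::int. of_int (2 * k) * lcoef x (2 * k)"
  have a: "(?b has_sum Phi_sqr 0) UNIV" using Phi_sqr_has_sum[of 0] x by simp
  have b: "((\<lambda>k. ?b k * (- 1) powi k) has_sum Phi_sqr (of_real (pi / 2))) UNIV"
    using Phi_sqr_has_sum[of "of_real (pi / 2)"] x unfolding exp_half_pi i_powi_even by simp
  have 1: "((\<lambda>k. ?b k * (- 1) powi k - ?b k) has_sum (Phi_sqr (of_real (pi / 2)) - Phi_sqr 0)) UNIV"
    by (rule has_sum_diff[OF b a])
  have "((\<lambda>m. - 4 * (of_int (2 * m + 1) ^ 1 * lcoef (x ^ 2) (2 * m + 1))) has_sum - 4 * Phi (x ^ 2) 1 0) UNIV"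
    by (intro has_sum_cmult_right Phi2)
  then have 2: "((\<lambda>m. ?b (2 * m + 1) * (- 1) powi (2 * m + 1) - ?b (2 * m + 1)) has_sum - 4 * Phi (x ^ 2) 1 0) UNIV"
    unfolding lcoef_power2 by (simp add: algebra_simps)
  have "((\<lambda>m. ?b (2 * m) * (- 1) powi (2 * m) - ?b (2 * m)) has_sum 0) UNIV" by simp
  from has_sum_unique[OF 1 has_sum_int_parity[OF this 2]]
  have "Phi_sqr (of_real (pi / 2)) - Phi_sqr 0 = - 4 * Phi (x ^ 2) 1 0" by simp
  moreover have "Phi_const = - (1 / 2 * Phi_sqr 0)"
    using Phi_0_square[of 0] x Phi_even_0[of 0] by (simp add: eq_neg_iff_add_eq_0)
  moreover have "Phi x 0 (of_real (pi / 2)) ^ 2 = Phi_const + 1 / 2 * Phi_sqr (of_real (pi / 2))"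
    using Phi_0_square[of "of_real (pi / 2)"] x by simp
  ultimately have "Phi x 0 (of_real (pi / 2)) ^ 2 = 1 / 2 * (- 4 * Phi (x ^ 2) 1 0)"
    by (metis (no_types, opaque_lifting) add.commute diff_conv_add_uminus right_diff_distrib)
  then have "Phi x 0 (of_real (pi / 2)) ^ 2 = - 2 * Phi (x ^ 2) 1 0" by simp
  then have "2 * (x ^ 2 * psi (x ^ 4) ^ 4) = Phi (x ^ 2) 1 0"
    unfolding Phi_0_half_pi by (simp add: power_mult_distrib flip: power_mult)
  then show ?thesis by (simp only: mult.assoc)
qed

end

lemma Phi_1_0:
  assumes "norm x < 1" "x \<noteq> 0"
  shows "Phi x 1 0 = 2 * x * psi (x ^ 2) ^ 4"
proof -
  have n: "norm (csqrt x) ^ 2 < 1" using assms(1) by (metis norm_power power2_csqrt)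
  have "csqrt x ^ 4 = x ^ 2" using power_mult[of "csqrt x" 2 2] by simp
  moreover have "norm (csqrt x) < 1" using n by (simp add: power_less_one_iff)
  ultimately show ?thesis using Phi_1_0_power2[of "csqrt x"] Phi_has_sum_0[OF assms, of 1] assms by simp
qed

subsection \<open>The fifth moment\<close>

lemma psi_nonzero: "norm q < 1 \<Longrightarrow> psi q \<noteq> 0"
  unfolding psi_def using euler_phi_nonzero[of q] euler_phi_nonzero[of "q ^ 2"]
  by (simp add: norm_power power_less_one_iff)

lemma Phi_5_0_eq:
  assumes x: "norm x < 1" "x \<noteq> 0"
  shows "Phi x 5 0 = 2 * (x * euler_phi (x ^ 2) ^ 12 + 256 * x ^ 3 * psi (x ^ 2) ^ 12)"
proof -
  have x2: "norm (x ^ 2) < 1" "x ^ 2 \<noteq> 0" and x4: "norm (x ^ 4) < 1"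
    using x by (simp_all add: norm_power power_less_one_iff)
  define F where "F = x * psi (x ^ 2) ^ 4"
  define G where "G = x ^ 2 * psi (x ^ 4) ^ 4"
  define b where "b = ode_coeff x"
  define \<theta> where "\<theta> = theta (x ^ 2) 1"
  have G0: "G \<noteq> 0" using x psi_nonzero[OF x4] by (simp add: G_def)
  have F1: "Phi x 1 0 = 2 * F" using Phi_1_0[OF x] by (simp add: F_def)
  have P2: "Phi x 0 (of_real (pi / 2)) ^ 2 = - 4 * G"
    unfolding Phi_0_half_pi[OF x] G_def by (simp add: power_mult_distrib flip: power_mult)
  have P4: "Phi x 0 (of_real (pi / 2)) ^ 4 = 16 * G ^ 2"
    using power_mult[of "Phi x 0 (of_real (pi / 2))" 2 2] unfolding P2 by (simp add: power_mult_distrib)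
  have b1: "F ^ 2 = - (b * G) - 16 * G ^ 2"
  proof -
    have "4 * F ^ 2 = 4 * (- (b * G) - 16 * G ^ 2)"
      using Phi_first_integral[OF x] unfolding F1 P2 P4 b_def[symmetric] by (simp add: algebra_simps power_mult_distrib)
    then show ?thesis by (simp only: mult_cancel_left) simp
  qed
  have FG: "F ^ 2 = \<theta> ^ 4 * G"
  proof -
    have "psi (x ^ 2) ^ 2 = \<theta> * psi (x ^ 4)"
      using theta_1_mult_psi[OF x2] by (simp add: \<theta>_def flip: power_mult)
    then have "psi (x ^ 2) ^ 8 = \<theta> ^ 4 * psi (x ^ 4) ^ 4"
      using power_mult[of "psi (x ^ 2)" 2 4] by (simp add: power_mult_distrib)
    then show ?thesis by (simp add: F_def G_def power_mult_distrib flip: power_mult)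
  qed
  have "- b * G = (\<theta> ^ 4 + 16 * G) * G" using b1 unfolding FG by (simp add: algebra_simps power2_eq_square)
  then have b: "b = - (\<theta> ^ 4 + 16 * G)" using G0 by (metis minus_equation_iff mult_cancel_right)
  \<comment> \<open>With \<open>F ^ 2 = \<theta> ^ 4 * G\<close>, the term \<open>64 * F ^ 2\<close>
    is four times the product of \<open>\<theta> ^ 4\<close> and \<open>16 * G\<close>, so
    subtracting it turns the square of their sum into that of their difference.\<close>
  have "b ^ 2 - 64 * F ^ 2 = (\<theta> ^ 4 - 16 * G) ^ 2"
    unfolding b FG by (simp add: power2_eq_square algebra_simps)
  also have "\<theta> ^ 4 - 16 * G = (euler_phi (x ^ 2) ^ 2 / euler_phi (x ^ 4)) ^ 4"
    using jacobi_quartic[OF x] theta_minus_1[OF x2] by (simp add: \<theta>_def G_def mult.assoc flip: power_mult)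
  finally have "b ^ 2 - 64 * F ^ 2 = ((euler_phi (x ^ 2) ^ 2 / euler_phi (x ^ 4)) ^ 4) ^ 2" .
  moreover have "F = x * (euler_phi (x ^ 4) ^ 2 / euler_phi (x ^ 2)) ^ 4"
    by (simp add: F_def psi_def flip: power_mult)
  \<comment> \<open>To be read with \<open>u = euler_phi (x ^ 4)\<close> and
    \<open>v = euler_phi (x ^ 2)\<close>; all powers of \<open>u\<close> cancel.\<close>
  moreover have "(u ^ 2 / v) ^ 4 * ((v ^ 2 / u) ^ 4) ^ 2 = v ^ 12" if "u \<noteq> 0" "v \<noteq> 0" for u v :: complex
    using that by (simp add: power_divide divide_simps flip: power_mult power_add)
  ultimately have key: "F * (b ^ 2 - 64 * F ^ 2) = x * euler_phi (x ^ 2) ^ 12"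
    using euler_phi_nonzero[OF x2(1)] euler_phi_nonzero[OF x4] by (simp only: mult.assoc simp_thms)
  have "Phi x 5 0 = 2 * (F * (b ^ 2 - 64 * F ^ 2) + 256 * F ^ 3)"
    unfolding Phi_5_0[OF x] F1 b_def[symmetric] by (simp add: power2_eq_square power3_eq_cube algebra_simps)
  then show ?thesis unfolding key by (simp add: F_def power_mult_distrib flip: power_mult)
qed

text \<open>\<open>(1 + y) * P4 y\<close> has the coefficients 1, 237, 1682, 1682, 237, 1, the type
  B Eulerian numbers, which form the numerator for fifth powers of odd numbers. The proof expands
  \<open>(2 * m + 1) ^ 5\<close> and sums the plain moments \<open>s k\<close>.\<close>

lemma odd_fifth_power_series:
  fixes y :: complex
  assumes y: "norm y < 1"
  shows "(\<lambda>m. of_nat (2 * m + 1) ^ 5 * y ^ m) sums ((1 + y) * P4 y / (1 - y) ^ 6)"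
proof -
  define s where "s k = (\<Sum>m. of_nat m ^ k * y ^ m)" for k
  have S: "(\<lambda>m. of_nat m ^ k * y ^ m) sums s k" for k
    unfolding s_def by (rule summable_sums, rule summable_norm_cancel)
      (use summable_power_geometric[of "norm y" k] y in \<open>simp add: norm_mult norm_power\<close>)
  \<comment> \<open>Shifting the index by one and expanding \<open>(m + 1) ^ k\<close> binomially
    relates each moment to the lower ones; \<open>0 ^ k\<close> is the term at \<open>m = 0\<close>,
    nonzero only for \<open>k = 0\<close>.\<close>
  have R: "s k - 0 ^ k = y * (\<Sum>i\<le>k. of_nat (k choose i) * s i)" for k
  proof (rule sums_unique2)
    show "(\<lambda>m. of_nat (Suc m) ^ k * y ^ Suc m) sums (s k - 0 ^ k)"
      using S[of k] by (subst sums_Suc_iff) simp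
    have "(\<lambda>m. y * (\<Sum>i\<le>k. of_nat (k choose i) * (of_nat m ^ i * y ^ m))) sums (y * (\<Sum>i\<le>k. of_nat (k choose i) * s i))"
      by (intro sums_mult sums_sum S)
    moreover have "y * (\<Sum>i\<le>k. of_nat (k choose i) * (of_nat m ^ i * y ^ m)) = of_nat (Suc m) ^ k * y ^ Suc m" for m
    proof -
      have "of_nat (Suc m) ^ k = (\<Sum>i\<le>k. of_nat (k choose i) * of_nat m ^ i :: complex)"
        using binomial_ring[of "of_nat m :: complex" 1 k] by (simp add: add.commute)
      then show ?thesis by (simp add: sum_distrib_left sum_distrib_right ac_simps)
    qed
    ultimately show "(\<lambda>m. of_nat (Suc m) ^ k * y ^ Suc m) sums (y * (\<Sum>i\<le>k. of_nat (k choose i) * s i))"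
      by (simp only:)
  qed
  define w where "w = 1 - y"
  have w0: "w \<noteq> 0" using y by (auto simp: w_def)
  have r: "w * s 0 = 1" "w * s 1 = y * s 0" "w * s 2 = y * (s 0 + 2 * s 1)"
    "w * s 3 = y * (s 0 + 3 * s 1 + 3 * s 2)"
    "w * s 4 = y * (s 0 + 4 * s 1 + 6 * s 2 + 4 * s 3)"
    "w * s 5 = y * (s 0 + 5 * s 1 + 10 * s 2 + 10 * s 3 + 5 * s 4)"
    using R[of 0] R[of 1] R[of 2] R[of 3] R[of 4] R[of 5]
    by (simp_all add: w_def numeral_eq_Suc algebra_simps)
  have e1: "w ^ 2 * s 1 = y" using r(1,2) by algebra
  have e2: "w ^ 3 * s 2 = y * (w + 2 * y)" using r(1,3) e1 by algebra
  have e3: "w ^ 4 * s 3 = y * (w ^ 2 + 3 * w * y + 3 * y * (w + 2 * y))" using r(1,4) e1 e2 by algebra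
  have e4: "w ^ 5 * s 4 = y * (w ^ 3 * (w * s 0) + 4 * w ^ 2 * (w ^ 2 * s 1) + 6 * w * (w ^ 3 * s 2) + 4 * (w ^ 4 * s 3))"
    using r(5) by algebra
  have e5: "w ^ 6 * s 5 = y * (w ^ 4 * (w * s 0) + 5 * w ^ 3 * (w ^ 2 * s 1) + 10 * w ^ 2 * (w ^ 3 * s 2) + 10 * w * (w ^ 4 * s 3) + 5 * (w ^ 5 * s 4))"
    using r(6) by algebra
  have "w ^ 6 * (32 * s 5 + 80 * s 4 + 80 * s 3 + 40 * s 2 + 10 * s 1 + s 0) =
      32 * (w ^ 6 * s 5) + 80 * w * (w ^ 5 * s 4) + 80 * w ^ 2 * (w ^ 4 * s 3) + 40 * w ^ 3 * (w ^ 3 * s 2)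
      + 10 * w ^ 4 * (w ^ 2 * s 1) + w ^ 5 * (w * s 0)"
    by algebra
  also have "\<dots> = (1 + y) * P4 y"
    unfolding e5 unfolding e4 unfolding e3 e2 e1 r(1) unfolding P4_def w_def by algebra
  finally have t: "32 * s 5 + 80 * s 4 + 80 * s 3 + 40 * s 2 + 10 * s 1 + s 0 = (1 + y) * P4 y / (1 - y) ^ 6"
    using w0 by (simp add: field_simps w_def)
  have "(\<lambda>m. 32 * (of_nat m ^ 5 * y ^ m) + 80 * (of_nat m ^ 4 * y ^ m) + 80 * (of_nat m ^ 3 * y ^ m)
      + 40 * (of_nat m ^ 2 * y ^ m) + 10 * (of_nat m ^ 1 * y ^ m) + of_nat m ^ 0 * y ^ m) sums
      (32 * s 5 + 80 * s 4 + 80 * s 3 + 40 * s 2 + 10 * s 1 + s 0)"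
    by (intro sums_add sums_mult S)
  moreover have "32 * (of_nat m ^ 5 * y ^ m) + 80 * (of_nat m ^ 4 * y ^ m) + 80 * (of_nat m ^ 3 * y ^ m)
      + 40 * (of_nat m ^ 2 * y ^ m) + 10 * (of_nat m ^ 1 * y ^ m) + of_nat m ^ 0 * y ^ m = of_nat (2 * m + 1) ^ 5 * y ^ m" for m
  proof -
    have "32 * (a ^ 5 * c) + 80 * (a ^ 4 * c) + 80 * (a ^ 3 * c) + 40 * (a ^ 2 * c) + 10 * (a ^ 1 * c) + a ^ 0 * c = (2 * a + 1) ^ 5 * c"
      for a c :: complex by algebra
    moreover have "of_nat (2 * m + 1) = 2 * of_nat m + (1 :: complex)" by simp
    ultimately show ?thesis by (simp only:)
  qed
  ultimately show ?thesis unfolding t by simp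
qed

text \<open>Both sides come from the double series of \<open>n ^ 5 * x ^ (n * (2 * k + 1))\<close>
  over odd \<open>n = 2 * m + 1\<close>: the sum over \<open>k\<close> gives \<open>lcoef\<close>,
  the sum over \<open>m\<close> gives \<open>P4\<close>. Negative odd \<open>n\<close> repeat the
  positive ones, hence the factor 2.\<close>

lemma Phi_5_0_series:
  assumes x: "norm x < 1" "x \<noteq> 0"
  shows "Phi x 5 0 = 2 * x * (\<Sum>k. (x ^ 2) ^ k * (1 + (x ^ 2) ^ (2 * k + 1)) * P4 ((x ^ 2) ^ (2 * k + 1)) / (1 - (x ^ 2) ^ (2 * k + 1)) ^ 6)"
proof -
  let ?r = "norm x"
  let ?a = "\<lambda>m k. of_nat (2 * m + 1) ^ 5 * x ^ ((2 * m + 1) * (2 * k + 1))"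
  have g: "(\<lambda>k::nat. ?r ^ k) summable_on UNIV"
    using x by (subst summable_on_UNIV_nonneg_real_iff) (auto intro: summable_geometric)
  have "(\<lambda>m::nat. real m ^ 5 * ?r ^ m) summable_on UNIV"
    using summable_power_geometric[of ?r 5] x by (subst summable_on_UNIV_nonneg_real_iff) auto
  then have "(\<lambda>m::nat. real m ^ 5 * ?r ^ m) summable_on range (\<lambda>m. 2 * m + 1)"
    using summable_on_subset_banach by blast
  then have m: "(\<lambda>m::nat. real (2 * m + 1) ^ 5 * ?r ^ (2 * m + 1)) summable_on UNIV"
    by (subst (asm) summable_on_reindex) (auto simp: inj_def o_def)
  \<comment> \<open>The exponent \<open>(2 * m + 1) * (2 * k + 1)\<close> is at least
    \<open>2 * m + 1 + k\<close>, so a product of two convergent series dominates.\<close>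
  have dom: "(\<lambda>(m, k). real (2 * m + 1) ^ 5 * ?r ^ (2 * m + 1) * ?r ^ k) summable_on UNIV \<times> UNIV"
  proof (rule summable_on_SigmaI)
    show "((\<lambda>k. case (m, k) of (m, k) \<Rightarrow> real (2 * m + 1) ^ 5 * ?r ^ (2 * m + 1) * ?r ^ k) has_sum
        real (2 * m + 1) ^ 5 * ?r ^ (2 * m + 1) * infsum (\<lambda>k. ?r ^ k) UNIV) UNIV" for m
      using has_sum_cmult_right[OF has_sum_infsum[OF g]] by simp
    show "(\<lambda>m. real (2 * m + 1) ^ 5 * ?r ^ (2 * m + 1) * infsum (\<lambda>k. ?r ^ k) UNIV) summable_on UNIV"
      by (rule summable_on_cmult_left[OF m])
  qed auto
  have bd: "norm (?a m k) \<le> real (2 * m + 1) ^ 5 * ?r ^ (2 * m + 1) * ?r ^ k" for m k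
  proof -
    have "?r ^ ((2 * m + 1) * (2 * k + 1)) \<le> ?r ^ (2 * m + 1 + k)"
      using x by (intro power_decreasing) (auto simp: algebra_simps)
    then have "real (2 * m + 1) ^ 5 * ?r ^ ((2 * m + 1) * (2 * k + 1)) \<le> real (2 * m + 1) ^ 5 * ?r ^ (2 * m + 1 + k)"
      by (intro mult_left_mono) auto
    then show ?thesis unfolding norm_mult norm_power norm_of_nat by (simp only: power_add mult.assoc)
  qed
  have "(\<lambda>(m, k). norm (?a m k)) summable_on UNIV \<times> UNIV"
    by (rule summable_on_comparison_test[OF dom]) (use bd in auto)
  then have "(\<lambda>(m, k). ?a m k) summable_on UNIV \<times> UNIV"
    using abs_summable_summable[of "\<lambda>(m, k). ?a m k"] by (simp add: case_prod_unfold)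
  then obtain T where T: "((\<lambda>(m, k). ?a m k) has_sum T) (UNIV \<times> UNIV)"
    unfolding summable_on_def by blast
  have T': "((\<lambda>(k, m). ?a m k) has_sum T) (UNIV \<times> UNIV)"
    using T by (subst has_sum_reindex_bij_witness[of _ "\<lambda>(m, k). (k, m)" "\<lambda>(k, m). (m, k)" _ "\<lambda>(m, k). ?a m k"]) auto
  have inner1: "((\<lambda>k. ?a m k) has_sum of_int (2 * int m + 1) ^ 5 * lcoef x (2 * int m + 1)) UNIV" for m
  proof -
    let ?n = "2 * m + 1"
    have n: "2 * int m + 1 = int ?n" by simp
    have y: "norm (x ^ (2 * ?n)) < 1" unfolding norm_power by (subst power_less_one_iff) (use x in auto)
    have "((\<lambda>k. (x ^ (2 * ?n)) ^ k) has_sum (1 / (1 - x ^ (2 * ?n)))) UNIV"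
      by (rule norm_summable_imp_has_sum) (use y geometric_sums[of "x ^ (2 * ?n)"] in \<open>auto simp: norm_power summable_geometric\<close>)
    then have "((\<lambda>k. of_nat ?n ^ 5 * x ^ ?n * (x ^ (2 * ?n)) ^ k) has_sum (of_nat ?n ^ 5 * x ^ ?n * (1 / (1 - x ^ (2 * ?n))))) UNIV"
      by (rule has_sum_cmult_right)
    moreover have "of_nat ?n ^ 5 * x ^ ?n * (x ^ (2 * ?n)) ^ k = ?a m k" for k
    proof -
      have "x ^ ?n * (x ^ (2 * ?n)) ^ k = x ^ (?n + 2 * ?n * k)" by (simp only: power_add power_mult)
      also have "?n + 2 * ?n * k = ?n * (2 * k + 1)" by (simp add: algebra_simps)
      finally show ?thesis by (simp only: mult.assoc)
    qed
    moreover have "of_nat ?n ^ 5 * x ^ ?n * (1 / (1 - x ^ (2 * ?n))) = of_int (2 * int m + 1) ^ 5 * lcoef x (2 * int m + 1)"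
    proof -
      have "x ^ ?n \<noteq> 0" using x by simp
      moreover have "1 - x ^ ?n * x ^ ?n \<noteq> 0"
        unfolding power_add[symmetric] by (rule one_minus_power_nonzero[OF x(1)]) simp
      ultimately have "c * (1 / (1 - c * c)) = 1 / (inverse c - c)" if "c = x ^ ?n" for c
        using that by (simp add: field_simps)
      then have "x ^ ?n * (1 / (1 - x ^ (2 * ?n))) = lcoef x (2 * int m + 1)"
        unfolding lcoef_def n power_int_minus power_int_of_nat mult_2[of ?n] power_add[of x ?n ?n] by blast
      then show ?thesis unfolding n of_int_of_nat_eq by (simp only: mult.assoc)
    qed
    ultimately show ?thesis by (simp only:)
  qed
  have A: "((\<lambda>m. of_int (2 * int m + 1) ^ 5 * lcoef x (2 * int m + 1)) has_sum T) UNIV"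
    by (rule has_sum_SigmaD[OF T]) (use inner1 in simp)
  have B: "((\<lambda>m. of_int (2 * (- 1 - int m) + 1) ^ 5 * lcoef x (2 * (- 1 - int m) + 1)) has_sum T) UNIV"
  proof -
    have "of_int (2 * (- 1 - int m) + 1) ^ 5 * lcoef x (2 * (- 1 - int m) + 1) = of_int (2 * int m + 1) ^ 5 * lcoef x (2 * int m + 1)" for m
    proof -
      have e: "2 * (- 1 - int m) + 1 = - (2 * int m + 1)" by simp
      have "(- of_int (2 * int m + 1)) ^ 5 = - ((of_int (2 * int m + 1) :: complex) ^ 5)" by (rule power_minus_odd) simp
      then show ?thesis unfolding e lcoef_minus of_int_minus by (simp only: minus_mult_minus)
    qed
    then show ?thesis using A by (simp only:)
  qed
  have "Phi x 5 0 = T + T"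
    using has_sum_unique[OF Phi_has_sum_0[OF x] has_sum_int_split[OF A B]] .
  moreover have "T = x * (\<Sum>k. (x ^ 2) ^ k * (1 + (x ^ 2) ^ (2 * k + 1)) * P4 ((x ^ 2) ^ (2 * k + 1)) / (1 - (x ^ 2) ^ (2 * k + 1)) ^ 6)"
  proof -
    let ?s = "\<lambda>k. (x ^ 2) ^ k * (1 + (x ^ 2) ^ (2 * k + 1)) * P4 ((x ^ 2) ^ (2 * k + 1)) / (1 - (x ^ 2) ^ (2 * k + 1)) ^ 6"
    have inner2: "((\<lambda>m. ?a m k) has_sum x * ?s k) UNIV" for k
    proof -
      have sm: "(\<lambda>m. ?a m k) summable_on UNIV"
        using summable_on_SigmaD1[of "\<lambda>k m. ?a m k" UNIV "\<lambda>_. UNIV" k] T' unfolding summable_on_def by auto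
      let ?y = "(x ^ 2) ^ (2 * k + 1)"
      have "norm ?y < 1" using x by (simp add: norm_power power_less_one_iff del: power_Suc flip: power_mult)
      from sums_mult[OF odd_fifth_power_series[OF this], of "x ^ (2 * k + 1)"]
      have "(\<lambda>m. x ^ (2 * k + 1) * (of_nat (2 * m + 1) ^ 5 * ?y ^ m)) sums (x ^ (2 * k + 1) * ((1 + ?y) * P4 ?y / (1 - ?y) ^ 6))" .
      moreover have "x ^ (2 * k + 1) * (of_nat (2 * m + 1) ^ 5 * ?y ^ m) = ?a m k" for m
      proof -
        have "x ^ (2 * k + 1) * ?y ^ m = x ^ ((2 * k + 1) + 2 * (2 * k + 1) * m)" by (simp only: power_add power_mult)
        also have "(2 * k + 1) + 2 * (2 * k + 1) * m = (2 * m + 1) * (2 * k + 1)" by (simp add: algebra_simps)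
        finally show ?thesis by (simp only: mult.left_commute[of "x ^ (2 * k + 1)"])
      qed
      moreover have "x ^ (2 * k + 1) * ((1 + ?y) * P4 ?y / (1 - ?y) ^ 6) = x * ?s k"
        by (simp add: power_mult)
      ultimately have "(\<lambda>m. ?a m k) sums (x * ?s k)" by (simp only:)
      from sums_unique2[OF this has_sum_imp_sums[OF has_sum_infsum[OF sm]]] show ?thesis
        using has_sum_infsum[OF sm] by simp
    qed
    have "((\<lambda>k. x * ?s k) has_sum T) UNIV"
      by (rule has_sum_SigmaD[OF T']) (use inner2 in simp)
    then have "(\<lambda>k. x * ?s k) sums T" by (rule has_sum_imp_sums)
    moreover have "(\<lambda>k. x * ?s k) sums (x * (\<Sum>k. ?s k))"
      by (intro sums_mult summable_sums summable_odd_lambert) (use x in \<open>simp add: norm_power power_less_one_iff\<close>)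
    ultimately show ?thesis by (rule sums_unique2)
  qed
  ultimately show ?thesis by simp
qed

text \<open>The even factors multiply to \<open>euler_phi (q ^ 2)\<close> and the odd ones to
  \<open>euler_phi q / euler_phi (q ^ 2)\<close> by \<open>qpoch_odd\<close>; the quotient is
  \<open>psi q\<close>.\<close>

lemma psi_prod:
  assumes q: "norm q < 1"
  shows "(\<Prod>n. (1 - q ^ (2 * (n + 1))) ^ 12 / (1 - q ^ (2 * (n + 1) - 1)) ^ 12) = psi q ^ 12"
proof -
  have q2: "norm (q ^ 2) < 1" using q by (simp add: norm_power power_less_one_iff)
  have a: "(\<lambda>n. 1 - q ^ (2 * (n + 1))) = (\<lambda>n. 1 - q ^ 2 * (q ^ 2) ^ n)"
    by (simp add: fun_eq_iff power_add power_mult power2_eq_square)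
  have b: "(\<lambda>n. 1 - q ^ (2 * (n + 1) - 1)) = (\<lambda>n. 1 - q * (q ^ 2) ^ n)"
    by (simp add: fun_eq_iff power_mult)
  have ha: "(\<lambda>n. 1 - q ^ (2 * (n + 1))) has_prod euler_phi (q ^ 2)"
    unfolding a euler_phi_conv_qpoch qpoch_def by (rule convergent_prod_has_prod[OF convergent_prod_qpoch[OF q2]])
  have hb: "(\<lambda>n. 1 - q ^ (2 * (n + 1) - 1)) has_prod (euler_phi q / euler_phi (q ^ 2))"
    unfolding b qpoch_odd[OF q, symmetric] qpoch_def by (rule convergent_prod_has_prod[OF convergent_prod_qpoch[OF q2]])
  have "(\<lambda>n. (1 - q ^ (2 * (n + 1))) ^ 12 / (1 - q ^ (2 * (n + 1) - 1)) ^ 12) has_prod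
      (euler_phi (q ^ 2) ^ 12 / (euler_phi q / euler_phi (q ^ 2)) ^ 12)"
    by (intro has_prod_divide has_prod_power ha hb)
  from has_prod_unique[OF this]
  have "(\<Prod>n. (1 - q ^ (2 * (n + 1))) ^ 12 / (1 - q ^ (2 * (n + 1) - 1)) ^ 12) = euler_phi (q ^ 2) ^ 12 / (euler_phi q / euler_phi (q ^ 2)) ^ 12"
    by simp
  also have "\<dots> = psi q ^ 12"
    using euler_phi_nonzero[OF q] euler_phi_nonzero[OF q2]
    by (simp add: psi_def power_divide divide_simps flip: power_mult power_add)
  finally show ?thesis .
qed

theorem theorem2p2:
  fixes q :: complex
  assumes "norm q < 1"
  shows "(\<Sum>k. q ^ k * (1 + q ^ (2 * k + 1)) * P4 (q ^ (2 * k + 1)) / (1 - q ^ (2 * k + 1)) ^ 6)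
           - euler_phi q ^ 12
         = 256 * q * (\<Prod>n. (1 - q ^ (2 * (n + 1))) ^ 12 / (1 - q ^ (2 * (n + 1) - 1)) ^ 12)"
\<comment> \<open>The square root \<open>x\<close> is inverted in \<open>lcoef\<close> and cancelled
  at the end, so \<open>q = 0\<close> is separate: there only the term \<open>k = 0\<close>
  survives, and it equals 1, as does \<open>euler_phi 0\<close>.\<close>
proof (cases "q = 0")
  case True
  have "(\<lambda>k. q ^ k * (1 + q ^ (2 * k + 1)) * P4 (q ^ (2 * k + 1)) / (1 - q ^ (2 * k + 1)) ^ 6) sums
      (\<Sum>k\<in>{0}. q ^ k * (1 + q ^ (2 * k + 1)) * P4 (q ^ (2 * k + 1)) / (1 - q ^ (2 * k + 1)) ^ 6)"
    by (rule sums_finite) (auto simp: True)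
  then have "(\<Sum>k. q ^ k * (1 + q ^ (2 * k + 1)) * P4 (q ^ (2 * k + 1)) / (1 - q ^ (2 * k + 1)) ^ 6) = 1"
    using True by (simp add: sums_iff P4_def)
  then show ?thesis using True by (simp add: euler_phi_def)
next
  case False
  define x where "x = csqrt q"
  have q: "q = x ^ 2" by (simp add: x_def)
  have x0: "x \<noteq> 0" using False by (simp add: x_def)
  have "norm x ^ 2 < 1" using assms by (simp add: q norm_power)
  then have x: "norm x < 1" by (simp add: power_less_one_iff)
  let ?S = "\<Sum>k. q ^ k * (1 + q ^ (2 * k + 1)) * P4 (q ^ (2 * k + 1)) / (1 - q ^ (2 * k + 1)) ^ 6"
  have "2 * x * ?S = 2 * (x * euler_phi q ^ 12 + 256 * x ^ 3 * psi q ^ 12)"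
    using Phi_5_0_series[OF x x0] Phi_5_0_eq[OF x x0] by (simp only: q)
  also have "\<dots> = 2 * x * (euler_phi q ^ 12 + 256 * q * psi q ^ 12)"
    by (simp add: q power2_eq_square power3_eq_cube algebra_simps)
  finally have "?S = euler_phi q ^ 12 + 256 * q * psi q ^ 12" using x0 by simp
  then show ?thesis unfolding psi_prod[OF assms] by simp
qed

end
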